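(* Let $n\ge 1$, $k\in\mathcal{K}$, and let $\bar{X}^{(n)}$ be the given spatial solution of the $n$-th iteration. The temporal sub-problem $\mathrm{TSP}_k^{(n)}$: $$\min_{\Gamma\ge 0}\ \Gamma_{dk0}$$ subject to $$\Gamma_{jkl'}\ \ge\ t_{mkl}+\Gamma_{ikl}\quad\text{for every arc } a_{mkl} \text{ (tail } v_{ikl}, \text{ head } v_{jkl'}) \text{ with } \bar{X}^{(n)}_{mkl}=1,$$ $$\text{either }\ \Gamma_{jkl}\le z^--t_{mkl}\quad\text{or}\quad \Gamma_{jkl}\ge z^+,\qquad \text{for every arc } a_{mkl} \text{ (tail } v_{jkl}) \text{ with } \bar{X}^{(n)}_{mkl}=1 \text{ and every } (z^-,z^+)\in Z_m,$$ is solvable in polynomial time.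
   Context: **Base data.** $G=(V,A,F^+,F^-)$ is a finite directed multi-graph (arc $a$ has head $F^+(a)$, tail $F^-(a)$), $\mathcal{K}$ a finite set of agents indexed $1,\dots,|\mathcal{K}|$, $v_1\in V$ the depot, $A_R\subset A$ the service arcs, $A_D=A\setminus A_R$ the deadhead arcs. Agent $k$ traverses $a_m$ in running-time $t_{mk}>0$; $W$ collects the $t_{mk}$. For each $a_m\in A$, $Z_m$ is a list of pairs $(z^-,z^+)$, each meaning that $a_m$ is unavailable from time $z^-$ to $z^+$; $Z=\bigcup_m Z_m$. **Standing assumptions.** The tuple $(G,Z,W)$ is well-defined: (1) every arc $a_m$ is available, somewhere in $[0,\infty)$, for a duration at least $\min_{k}t_{mk}$; (2) there are no availability periods (gaps between two unavailability periods) of an arc that are smaller than its running-time for all agents; (3) the graph $(V,A_D)$ is strongly connected. It is also $T_p$-recurrent: each arc is available at least once in every time interval of length $T_p$ (so that, for every $t\ge0$, every arc $a_m$ is traversable within $[t,t+T_p+t_{mk}]$ for some agent $k$). **Replicated graph.** Let $\mathcal{L}=\{1,\dots,|A_R|+1\}$. The replicated graph $\mathcal{G}=(\mathcal{V},\mathcal{A},\mathcal{F}^+,\mathcal{F}^-)$ has vertices $v_{ikl}$ ($v_i\in V$, $k\in\mathcal{K}$, $l\in\mathcal{L}$) and a source $v_{sk0}$ and destination $v_{dk0}$ for each $k$. Its arcs are: a copy $a_{mkl}$ of each $a_m\in A_D$ inside each layer $l$ of each agent $k$; for each $a_m\in A_R$ with tail $v_i$ and head $v_j$, each $k$ and $1\le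 l\le|\mathcal{L}|-1$, a copy $a_{mkl}$ from $v_{ikl}$ to $v_{jk(l+1)}$; and virtual arcs: from $v_{sk0}$ to $v_{1k1}$, from $v_{1kl}$ to $v_{dk0}$ for each $l\ge2$, from $v_{sk0}$ to $v_{dk0}$, and inter-agent arcs from $v_{dk0}$ to $v_{sk'0}$, where $k'$ is the cyclic successor of $k$. Copies inherit $t_{mkl}=t_{mk}$ and the list $Z_m$; virtual arcs have zero running-time and no unavailabilities. $\mathcal{A}_m$ is the set of copies of $a_m\in A_R$. **Spatial solution.** $\bar{X}^{(n)}$ is a vector in $\mathcal{S}_X$, the set of all $X\in\{0,1\}^{|\mathcal{A}|}$ such that at every vertex of $\mathcal{G}$ the sum of $X$ over outgoing arcs equals the sum over incoming arcs, and $\sum_{a_{mkl}\in\mathcal{A}_m}X_{mkl}=1$ for each $a_m\in A_R$. It is fixed data of the sub-problem (obtained from a master routing problem in iteration $n$). $\mathrm{TSP}_k^{(n)}$ involves only the arcs of agent $k$ (inter-agent arcs excluded) and the variables $\Gamma$ (one nonnegative real per vertex of agent $k$'s part of $\mathcal{G}$). *)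

theory Defs
  imports
    Complex_Main
    "HOL-Library.Log_Nat"
    "HOL-Computational_Algebra.Polynomial"
    "Graph_Theory.Digraph_Component"
begin

section \<open>Polynomial-time computation with numerical data\<close>

text \<open>
  The machine model is a random access machine, programmed in a structured language.  Its memory
  consists of arrays of natural numbers (for combinatorial data, counters and addresses) and arrays
  of numbers; a program mentions only finitely many arrays, and a scalar is an array used at
  index 0 only.  The arithmetic operations are addition and subtraction, the tests are comparisons.

  The cost semantics is parameterised by the cost \<open>sz x\<close> of handling the number \<open>x\<close>.  With
  \<open>sz x = 1\<close> this is the arithmetic model, for arbitrary real data.  With \<open>sz x\<close> the binary length of
  the rational \<open>x\<close>, it is the logarithmic-cost random access machine on rational data, which is
  polynomially equivalent to Turing machines.  Natural numbers are charged by their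
  binary length in both cases.
\<close>

datatype nexp = NC nat | NM nat nexp | NPlus nexp nexp | NMinus nexp nexp

datatype rexp = RC rat | RM nat nexp | RPlus rexp rexp | RMinus rexp rexp

datatype bexp = NLess nexp nexp | RLess rexp rexp | BNot bexp | BAnd bexp bexp

datatype com =
    Skip
  | NAssign nat nexp nexp
  | RAssign nat nexp rexp
  | Seq com com
  | Cond bexp com com
  | While bexp com

record state =
  nmem :: "nat \<Rightarrow> nat \<Rightarrow> nat"
  rmem :: "nat \<Rightarrow> nat \<Rightarrow> real"

fun nval :: "nexp \<Rightarrow> state \<Rightarrow> nat" where
  "nval (NC c) s = c"
| "nval (NM a e) s = nmem s a (nval e s)"
| "nval (NPlus e f) s = nval e s + nval f s"
| "nval (NMinus e f) s = nval e s - nval f s"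

fun rval :: "rexp \<Rightarrow> state \<Rightarrow> real" where
  "rval (RC c) s = real_of_rat c"
| "rval (RM a e) s = rmem s a (nval e s)"
| "rval (RPlus e f) s = rval e s + rval f s"
| "rval (RMinus e f) s = rval e s - rval f s"

fun bval :: "bexp \<Rightarrow> state \<Rightarrow> bool" where
  "bval (NLess e f) s \<longleftrightarrow> nval e s < nval f s"
| "bval (RLess e f) s \<longleftrightarrow> rval e s < rval f s"
| "bval (BNot b) s \<longleftrightarrow> \<not> bval b s"
| "bval (BAnd b c) s \<longleftrightarrow> bval b s \<and> bval c s"

definition nat_bits :: "nat \<Rightarrow> nat" where
  "nat_bits n = max 1 (floorlog 2 n)"

text \<open>Binary length of a rational in lowest terms, including the sign; only meant for rational
  arguments.\<close>
definition rat_bits :: "real \<Rightarrow> nat" where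
  "rat_bits x = (let (p, q) = quotient_of (THE r. real_of_rat r = x)
     in 1 + nat_bits (nat \<bar>p\<bar>) + nat_bits (nat q))"

fun ncost :: "nexp \<Rightarrow> state \<Rightarrow> nat" where
  "ncost (NC c) s = nat_bits c"
| "ncost (NM a e) s = ncost e s + nat_bits (nval (NM a e) s)"
| "ncost (NPlus e f) s = ncost e s + ncost f s + nat_bits (nval (NPlus e f) s)"
| "ncost (NMinus e f) s = ncost e s + ncost f s + nat_bits (nval (NMinus e f) s)"

fun rcost :: "(real \<Rightarrow> nat) \<Rightarrow> rexp \<Rightarrow> state \<Rightarrow> nat" where
  "rcost sz (RC c) s = sz (real_of_rat c)"
| "rcost sz (RM a e) s = ncost e s + sz (rval (RM a e) s)"
| "rcost sz (RPlus e f) s = rcost sz e s + rcost sz f s + sz (rval (RPlus e f) s)"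
| "rcost sz (RMinus e f) s = rcost sz e s + rcost sz f s + sz (rval (RMinus e f) s)"

fun bcost :: "(real \<Rightarrow> nat) \<Rightarrow> bexp \<Rightarrow> state \<Rightarrow> nat" where
  "bcost sz (NLess e f) s = 1 + ncost e s + ncost f s"
| "bcost sz (RLess e f) s = 1 + rcost sz e s + rcost sz f s"
| "bcost sz (BNot b) s = 1 + bcost sz b s"
| "bcost sz (BAnd b c) s = 1 + bcost sz b s + bcost sz c s"

definition nstore :: "nat \<Rightarrow> nat \<Rightarrow> nat \<Rightarrow> state \<Rightarrow> state" where
  "nstore a i x s = s\<lparr>nmem := (nmem s)(a := (nmem s a)(i := x))\<rparr>"

definition rstore :: "nat \<Rightarrow> nat \<Rightarrow> real \<Rightarrow> state \<Rightarrow> state" where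
  "rstore a i x s = s\<lparr>rmem := (rmem s)(a := (rmem s a)(i := x))\<rparr>"

text \<open>\<open>exec sz c s t s'\<close>: program \<open>c\<close> started in \<open>s\<close> terminates in \<open>s'\<close> at total cost \<open>t\<close>.\<close>
inductive exec :: "(real \<Rightarrow> nat) \<Rightarrow> com \<Rightarrow> state \<Rightarrow> nat \<Rightarrow> state \<Rightarrow> bool" for sz where
  Skip: "exec sz Skip s 1 s"
| NAssign: "exec sz (NAssign a e f) s (1 + ncost e s + ncost f s)
    (nstore a (nval e s) (nval f s) s)"
| RAssign: "exec sz (RAssign a e f) s (1 + ncost e s + rcost sz f s)
    (rstore a (nval e s) (rval f s) s)"
| Seq: "exec sz c s t s' \<Longrightarrow> exec sz d s' u s'' \<Longrightarrow> exec sz (Seq c d) s (t + u) s''"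
| CondTrue: "bval b s \<Longrightarrow> exec sz c s t s' \<Longrightarrow> exec sz (Cond b c d) s (bcost sz b s + t) s'"
| CondFalse: "\<not> bval b s \<Longrightarrow> exec sz d s t s' \<Longrightarrow> exec sz (Cond b c d) s (bcost sz b s + t) s'"
| WhileFalse: "\<not> bval b s \<Longrightarrow> exec sz (While b c) s (bcost sz b s) s"
| WhileTrue: "bval b s \<Longrightarrow> exec sz c s t s' \<Longrightarrow> exec sz (While b c) s' u s'' \<Longrightarrow>
    exec sz (While b c) s (bcost sz b s + t + u) s''"

lemma exec_deterministic:
  "exec sz c s t s' \<Longrightarrow> exec sz c s u s'' \<Longrightarrow> u = t \<and> s'' = s'"
proof (induction arbitrary: u s'' rule: exec.induct)
  case (Seq c s t s' d w s2)
  from Seq.prems show ?case by (cases rule: exec.cases) (auto dest!: Seq.IH)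
next
  case (CondTrue b s c t s' d)
  from CondTrue.prems CondTrue.hyps show ?case by (cases rule: exec.cases) (auto dest!: CondTrue.IH)
next
  case (CondFalse b s d t s' c)
  from CondFalse.prems CondFalse.hyps show ?case by (cases rule: exec.cases) (auto dest!: CondFalse.IH)
next
  case (WhileTrue b s c t s' w s2)
  from WhileTrue.prems WhileTrue.hyps(1) show ?case
    by (cases rule: exec.cases) (auto dest!: WhileTrue.IH)
next
  case (WhileFalse b s c)
  from WhileFalse.prems WhileFalse.hyps show ?case by (cases rule: exec.cases) auto
qed (erule exec.cases; simp)+

text \<open>An input is a word of natural numbers and a word of numbers, stored in the two arrays with
  number 0; all other memory cells are 0.\<close>
type_synonym input = "nat list \<times> real list"

definition load :: "input \<Rightarrow> state" where
  "load w = \<lparr>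
     nmem = (\<lambda>a i. if a = 0 \<and> i < length (fst w) then fst w ! i else 0),
     rmem = (\<lambda>a i. if a = 0 \<and> i < length (snd w) then snd w ! i else 0)\<rparr>"

definition input_size :: "(real \<Rightarrow> nat) \<Rightarrow> input \<Rightarrow> nat" where
  "input_size sz w = sum_list (map nat_bits (fst w)) + sum_list (map sz (snd w))"

definition solves_in_poly_time ::
    "(real \<Rightarrow> nat) \<Rightarrow> com \<Rightarrow> 'i set \<Rightarrow> ('i \<Rightarrow> input) \<Rightarrow> ('i \<Rightarrow> state \<Rightarrow> bool) \<Rightarrow> bool" where
  "solves_in_poly_time sz c D enc ok \<longleftrightarrow>
     (\<exists>p :: nat poly. \<forall>x\<in>D. \<exists>t s'. exec sz c (load (enc x)) t s' \<and>
        t \<le> poly p (input_size sz (enc x)) \<and> ok x s')"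

text \<open>
  For instances with real data, the usual notion: one algorithm solves all instances, its number of
  arithmetic steps is polynomial in the size of the combinatorial data plus the number of reals,
  and on rational data it runs in polynomial time in the bit model.
\<close>
definition solvable_in_polynomial_time ::
    "'i set \<Rightarrow> ('i \<Rightarrow> input) \<Rightarrow> ('i \<Rightarrow> state \<Rightarrow> bool) \<Rightarrow> bool" where
  "solvable_in_polynomial_time D enc ok \<longleftrightarrow>
     (\<exists>c. solves_in_poly_time (\<lambda>_. 1) c D enc ok \<and>
          solves_in_poly_time rat_bits c {x \<in> D. set (snd (enc x)) \<subseteq> \<rat>} enc ok)"


section \<open>Base data and standing assumptions\<close>

text \<open>Vertices, arcs and agents are identified with their indices \<open>1, 2, \<dots>\<close>; the depot is the
  vertex \<open>1\<close>.\<close>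
record base =
  base_graph :: "(nat, nat) pre_digraph"
  num_agents :: nat
  service :: "nat set"
  rtime :: "nat \<Rightarrow> nat \<Rightarrow> real"  \<comment> \<open>arc, agent\<close>
  unav :: "nat \<Rightarrow> (real \<times> real) list"

abbreviation num_verts :: "base \<Rightarrow> nat" where "num_verts B \<equiv> card (verts (base_graph B))"
abbreviation num_arcs :: "base \<Rightarrow> nat" where "num_arcs B \<equiv> card (arcs (base_graph B))"

definition agents :: "base \<Rightarrow> nat set" where
  "agents B = {1..num_agents B}"

text \<open>Unavailability periods are taken open, so that an arc may be left exactly when a period starts
  and entered exactly when it ends; this is the convention of the constraints of the temporal
  sub-problem.\<close>
definition available :: "base \<Rightarrow> nat \<Rightarrow> real set \<Rightarrow> bool" where
  "available B m T \<longleftrightarrow> (\<forall>(z, z') \<in> set (unav B m). T \<inter> {z<..<z'} = {})"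

definition well_formed :: "base \<Rightarrow> bool" where
  "well_formed B \<longleftrightarrow>
     wf_digraph (base_graph B) \<and>
     verts (base_graph B) = {1..num_verts B} \<and> arcs (base_graph B) = {1..num_arcs B} \<and>
     1 \<in> verts (base_graph B) \<and> 1 \<le> num_agents B \<and> service B \<subseteq> arcs (base_graph B) \<and>
     (\<forall>m\<in>arcs (base_graph B). \<forall>k\<in>agents B. 0 < rtime B m k) \<and>
     (\<forall>m\<in>arcs (base_graph B). \<forall>(z, z') \<in> set (unav B m). z \<le> z')"

definition well_defined :: "base \<Rightarrow> bool" where
  "well_defined B \<longleftrightarrow>
     (\<forall>m\<in>arcs (base_graph B). \<exists>t\<ge>0. available B m {t..t + Min (rtime B m ` agents B)}) \<and>
     (\<forall>m\<in>arcs (base_graph B). \<forall>(x, x') \<in> set (unav B m). \<forall>(z, z') \<in> set (unav B m).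
        x' < z \<and> available B m {x'..z} \<longrightarrow> (\<exists>k\<in>agents B. rtime B m k \<le> z - x')) \<and>
     strongly_connected ((base_graph B)\<lparr>arcs := arcs (base_graph B) - service B\<rparr>)"

definition recurrent :: "base \<Rightarrow> real \<Rightarrow> bool" where
  "recurrent B Tp \<longleftrightarrow> 0 < Tp \<and>
     (\<forall>m\<in>arcs (base_graph B). \<forall>t\<ge>0. \<exists>k\<in>agents B. \<exists>u. t \<le> u \<and>
        u + rtime B m k \<le> t + Tp + rtime B m k \<and> available B m {u..u + rtime B m k})"


section \<open>Replicated graph and spatial solutions\<close>

datatype rvertex =
    Vert nat nat nat  \<comment> \<open>vertex, agent, layer\<close>
  | Src nat
  | Dst nat

datatype rarc =
    Copy nat nat nat  \<comment> \<open>arc, agent, layer\<close>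
  | Start nat         \<comment> \<open>from the source to the depot in layer 1\<close>
  | End nat nat       \<comment> \<open>agent, layer: from the depot to the destination\<close>
  | Direct nat        \<comment> \<open>from the source to the destination\<close>
  | Inter nat         \<comment> \<open>from the destination to the source of the next agent\<close>

definition num_layers :: "base \<Rightarrow> nat" where
  "num_layers B = card (service B) + 1"

definition last_layer :: "base \<Rightarrow> nat \<Rightarrow> nat" where
  "last_layer B m = (if m \<in> service B then num_layers B - 1 else num_layers B)"

definition agent_verts :: "base \<Rightarrow> nat \<Rightarrow> rvertex set" where
  "agent_verts B k = {Vert i k l | i l. i \<in> verts (base_graph B) \<and> l \<in> {1..num_layers B}} \<union> {Src k, Dst k}"

definition agent_arcs :: "base \<Rightarrow> nat \<Rightarrow> rarc set" where
  "agent_arcs B k = {Copy m k l | m l. m \<in> arcs (base_graph B) \<and> l \<in> {1..last_layer B m}} \<union>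
     {End k l | l. l \<in> {2..num_layers B}} \<union> {Start k, Direct k}"

fun rtail :: "base \<Rightarrow> rarc \<Rightarrow> rvertex" where
  "rtail B (Copy m k l) = Vert (tail (base_graph B) m) k l"
| "rtail B (Start k) = Src k"
| "rtail B (End k l) = Vert 1 k l"
| "rtail B (Direct k) = Src k"
| "rtail B (Inter k) = Dst k"

fun rhead :: "base \<Rightarrow> rarc \<Rightarrow> rvertex" where
  "rhead B (Copy m k l) = Vert (head (base_graph B) m) k (if m \<in> service B then l + 1 else l)"
| "rhead B (Start k) = Vert 1 k 1"
| "rhead B (End k l) = Dst k"
| "rhead B (Direct k) = Dst k"
| "rhead B (Inter k) = Src (k mod num_agents B + 1)"

definition replicated_graph :: "base \<Rightarrow> (rvertex, rarc) pre_digraph" where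
  "replicated_graph B = \<lparr>
     verts = (\<Union>k\<in>agents B. agent_verts B k),
     arcs = (\<Union>k\<in>agents B. agent_arcs B k) \<union> Inter ` agents B,
     tail = rtail B, head = rhead B\<rparr>"

fun arc_time :: "base \<Rightarrow> rarc \<Rightarrow> real" where
  "arc_time B (Copy m k l) = rtime B m k"
| "arc_time B _ = 0"

fun arc_unav :: "base \<Rightarrow> rarc \<Rightarrow> (real \<times> real) list" where
  "arc_unav B (Copy m k l) = unav B m"
| "arc_unav B _ = []"

definition copies :: "base \<Rightarrow> nat \<Rightarrow> rarc set" where
  "copies B m = {Copy m k l | k l. k \<in> agents B \<and> l \<in> {1..last_layer B m}}"

definition spatial_solutions :: "base \<Rightarrow> (rarc \<Rightarrow> nat) set" where
  "spatial_solutions B = {X.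
     (\<forall>a \<in> arcs (replicated_graph B). X a \<in> {0, 1}) \<and>
     (\<forall>v \<in> verts (replicated_graph B).
        sum X (out_arcs (replicated_graph B) v) = sum X (in_arcs (replicated_graph B) v)) \<and>
     (\<forall>m \<in> service B. sum X (copies B m) = 1)}"


section \<open>The temporal sub-problem\<close>

definition tsp_feasible :: "base \<Rightarrow> (rarc \<Rightarrow> nat) \<Rightarrow> nat \<Rightarrow> (rvertex \<Rightarrow> real) \<Rightarrow> bool" where
  "tsp_feasible B X k \<Gamma> \<longleftrightarrow>
     (\<forall>v \<in> agent_verts B k. 0 \<le> \<Gamma> v) \<and>
     (\<forall>a \<in> agent_arcs B k. X a = 1 \<longrightarrow> \<Gamma> (rhead B a) \<ge> arc_time B a + \<Gamma> (rtail B a)) \<and>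
     (\<forall>a \<in> agent_arcs B k. X a = 1 \<longrightarrow> (\<forall>(z, z') \<in> set (arc_unav B a).
        \<Gamma> (rtail B a) \<le> z - arc_time B a \<or> \<Gamma> (rtail B a) \<ge> z'))"

definition tsp_optimal :: "base \<Rightarrow> (rarc \<Rightarrow> nat) \<Rightarrow> nat \<Rightarrow> (rvertex \<Rightarrow> real) \<Rightarrow> bool" where
  "tsp_optimal B X k \<Gamma> \<longleftrightarrow> tsp_feasible B X k \<Gamma> \<and>
     (\<forall>\<Gamma>'. tsp_feasible B X k \<Gamma>' \<longrightarrow> \<Gamma> (Dst k) \<le> \<Gamma>' (Dst k))"

definition agent_arc_list :: "base \<Rightarrow> nat \<Rightarrow> rarc list" where
  "agent_arc_list B k = [Start k, Direct k] @ map (End k) [2..<num_layers B + 1] @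
     concat (map (\<lambda>m. map (Copy m k) [1..<last_layer B m + 1]) [1..<num_arcs B + 1])"

lemma set_agent_arc_list:
  assumes "well_formed B"
  shows "set (agent_arc_list B k) = agent_arcs B k"
proof -
  have "arcs (base_graph B) = {1..num_arcs B}" using assms by (simp add: well_formed_def)
  then have "m \<in> arcs (base_graph B) \<longleftrightarrow> 1 \<le> m \<and> m < num_arcs B + 1" for m
    by (metis Suc_eq_plus1 atLeastAtMost_iff less_Suc_eq_le)
  then show ?thesis by (auto simp: agent_arc_list_def agent_arcs_def image_iff)
qed

text \<open>Only the data of agent \<open>k\<close> are part of the input: the graph with its service arcs, the entries
  of the spatial solution at the arcs of agent \<open>k\<close>, and for each arc its running-time for agent \<open>k\<close>
  and its unavailabilities.\<close>
definition tsp_input :: "base \<Rightarrow> (rarc \<Rightarrow> nat) \<Rightarrow> nat \<Rightarrow> input" where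
  "tsp_input B X k =
     ([num_verts B, num_arcs B, card (service B)] @
      concat (map (\<lambda>m. [tail (base_graph B) m, head (base_graph B) m, of_bool (m \<in> service B),
                        length (unav B m)]) [1..<num_arcs B + 1]) @
      map X (agent_arc_list B k),
      concat (map (\<lambda>m. rtime B m k # concat (map (\<lambda>(z, z'). [z, z']) (unav B m)))
        [1..<num_arcs B + 1]))"

fun vertex_index :: "base \<Rightarrow> rvertex \<Rightarrow> nat" where
  "vertex_index B (Vert i k l) = (l - 1) * num_verts B + (i - 1)"
| "vertex_index B (Src k) = num_layers B * num_verts B"
| "vertex_index B (Dst k) = num_layers B * num_verts B + 1"

text \<open>The algorithm returns 1 and the values of an optimal \<open>\<Gamma>\<close>, or it returns 0 if there is no feasible
  \<open>\<Gamma>\<close> (a spatial solution may contain cycles of deadhead arcs inside a layer).\<close>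
definition tsp_answer :: "base \<Rightarrow> (rarc \<Rightarrow> nat) \<Rightarrow> nat \<Rightarrow> state \<Rightarrow> bool" where
  "tsp_answer B X k s \<longleftrightarrow>
     nmem s 0 0 = 1 \<and> tsp_optimal B X k (\<lambda>v. rmem s 0 (vertex_index B v)) \<or>
     nmem s 0 0 = 0 \<and> (\<nexists>\<Gamma>. tsp_feasible B X k \<Gamma>)"

end

theory Submission
  imports Defs
begin

text \<open>
  Two observations make the sub-problem easy.  First, a feasible \<open>\<Gamma>\<close> is a point that satisfies finitely
  many constraints of two shapes: \<open>\<Gamma> u + t \<le> \<Gamma> v\<close> with \<open>t \<ge> 0\<close>, and \<open>\<Gamma> u \<notin> {lo<..<hi}\<close>.  Both are
  preserved by pointwise infima, so a feasible instance has a least feasible point, and this point is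
  optimal.  Secondly, the least point is reached from \<open>0\<close> by the obvious repair procedure: whenever a
  constraint is violated, raise the offending coordinate just enough to repair it.  A repair never
  overshoots the least point.

  The number of sweeps through all constraints is bounded by a potential.  A coordinate is called final
  if it has its least value.  As long as some coordinate is not final, one of them, say \<open>v\<close>, has only
  final predecessors, because the deadhead and service arcs have positive running-times, and of the
  virtual arcs only those from the depot to the destination matter: the source has value 0 in the least
  point, so the arcs that leave it impose nothing.  During the next sweep either \<open>v\<close> becomes final or
  it jumps over a forbidden interval, since otherwise the least point could be lowered at \<open>v\<close>
  (\<open>progress_sweep\<close>).  Hence the number of final coordinates plus the number of passed intervals
  grows with every sweep, and after as many sweeps as there are vertices and intervals nothing moves
  any more, if the instance is feasible.  If a further sweep still changes something, the instance is
  infeasible; this happens exactly if the spatial solution contains a cycle of arcs inside a layer.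
  The lemma \<open>sweeps_solve\<close> states this for abstract constraint lists.

  The program \<open>solve_tsp\<close> decodes the input into the two constraint lists and sweeps.  The number of
  vertices is given in binary, so the bound on the number of sweeps is polynomial only because a
  strongly connected deadhead graph has at most one vertex more than it has arcs (\<open>verts_le_arcs\<close>).

  Both cost models are treated at once by counting unit steps.  The machine can only add and subtract,
  so a step increases the binary length of the largest number by at most one; a run of \<open>n\<close> steps on
  numbers of length \<open>b\<close> therefore costs at most about \<open>n * (b + n)\<close>.  The predicate \<open>runs\<close>
  incorporates this estimate, and \<open>solvable_by_reach\<close> turns a polynomial number of unit steps into
  polynomial cost in both models.  For rational data all numbers that occur are fractions over one
  common denominator, whose length is bounded by the size of the input.
\<close>

section \<open>Unit steps and their cost\<close>

text \<open>
  A constant counts with its value, so that its binary length and its contribution to the growth of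
  numbers are covered by its size.
\<close>
fun nsize :: "nexp \<Rightarrow> nat" where
  "nsize (NC c) = 1 + c"
| "nsize (NM a e) = 1 + nsize e"
| "nsize (NPlus e f) = 1 + nsize e + nsize f"
| "nsize (NMinus e f) = 1 + nsize e + nsize f"

fun rsize :: "rexp \<Rightarrow> nat" where
  "rsize (RC c) = 1"
| "rsize (RM a e) = 1 + nsize e"
| "rsize (RPlus e f) = 1 + rsize e + rsize f"
| "rsize (RMinus e f) = 1 + rsize e + rsize f"

fun bsize :: "bexp \<Rightarrow> nat" where
  "bsize (NLess e f) = 1 + nsize e + nsize f"
| "bsize (RLess e f) = 1 + rsize e + rsize f"
| "bsize (BNot b) = 1 + bsize b"
| "bsize (BAnd b c) = 1 + bsize b + bsize c"

text \<open>
  The only rational constant whose length is controlled uniformly over all number ranges is 0.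
\<close>
fun rzero :: "rexp \<Rightarrow> bool" where
  "rzero (RC c) \<longleftrightarrow> c = 0"
| "rzero (RM a e) \<longleftrightarrow> True"
| "rzero (RPlus e f) \<longleftrightarrow> rzero e \<and> rzero f"
| "rzero (RMinus e f) \<longleftrightarrow> rzero e \<and> rzero f"

fun bzero :: "bexp \<Rightarrow> bool" where
  "bzero (NLess e f) \<longleftrightarrow> True"
| "bzero (RLess e f) \<longleftrightarrow> rzero e \<and> rzero f"
| "bzero (BNot b) \<longleftrightarrow> bzero b"
| "bzero (BAnd b c) \<longleftrightarrow> bzero b \<and> bzero c"

text \<open>
  \<open>R b\<close> is the range of numbers of length about \<open>b\<close>.  The length of a sum or difference exceeds that
  of its arguments by at most one, which fails for a naive bound on the lengths of numerator and
  denominator; the ranges are needed to keep the denominator fixed.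
\<close>
definition size_model :: "(real \<Rightarrow> nat) \<Rightarrow> (nat \<Rightarrow> real set) \<Rightarrow> nat \<Rightarrow> bool" where
  "size_model sz R d \<longleftrightarrow> mono R \<and> (\<forall>b. 0 \<in> R b) \<and>
     (\<forall>b. \<forall>x\<in>R b. \<forall>y\<in>R b. x + y \<in> R (Suc b) \<and> x - y \<in> R (Suc b)) \<and>
     (\<forall>b. \<forall>x\<in>R b. sz x \<le> b + d)"

definition bounded_state :: "(nat \<Rightarrow> real set) \<Rightarrow> nat \<Rightarrow> state \<Rightarrow> bool" where
  "bounded_state R b s \<longleftrightarrow> (\<forall>a i. nmem s a i < 2 ^ b \<and> rmem s a i \<in> R b)"

lemma size_modelD:
  assumes "size_model sz R d"
  shows "b \<le> c \<Longrightarrow> x \<in> R b \<Longrightarrow> x \<in> R c" "0 \<in> R b"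
    "x \<in> R b \<Longrightarrow> y \<in> R b \<Longrightarrow> x + y \<in> R (Suc b)"
    "x \<in> R b \<Longrightarrow> y \<in> R b \<Longrightarrow> x - y \<in> R (Suc b)"
    "x \<in> R b \<Longrightarrow> sz x \<le> b + d"
  using assms unfolding size_model_def mono_def by blast+

lemma nat_bits_le:
  assumes "x < 2 ^ b" "0 < b"
  shows "nat_bits x \<le> b"
  using assms floorlog_leD floorlog_le_iff[of 2 x b] by (simp add: nat_bits_def)

lemma nval_bound:
  assumes "bounded_state R b s"
  shows "nval e s < 2 ^ (b + nsize e)"
proof (induction e)
  case (NC c)
  have "c < 2 ^ c" by simp
  also have "(2::nat) ^ c \<le> 2 ^ (b + nsize (NC c))" by (rule power_increasing) auto
  finally show ?case by simp
next
  case (NM a e)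
  have "nmem s a (nval e s) < 2 ^ b" using assms by (simp add: bounded_state_def)
  also have "(2::nat) ^ b \<le> 2 ^ (b + nsize (NM a e))" by (rule power_increasing) auto
  finally show ?case by simp
next
  case (NPlus e f)
  have "(2::nat) ^ (b + nsize e) \<le> 2 ^ (b + nsize e + nsize f)"
    "(2::nat) ^ (b + nsize f) \<le> 2 ^ (b + nsize e + nsize f)" by (auto intro: power_increasing)
  with NPlus have "nval e s < 2 ^ (b + nsize e + nsize f)" "nval f s < 2 ^ (b + nsize e + nsize f)"
    by (meson less_le_trans)+
  then show ?case by (simp add: add.assoc)
next
  case (NMinus e f)
  have "nval (NMinus e f) s \<le> nval e s" by simp
  also note NMinus(1)
  also have "(2::nat) ^ (b + nsize e) \<le> 2 ^ (b + nsize (NMinus e f))"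
    by (rule power_increasing) auto
  finally show ?case .
qed

lemma nsize_pos: "0 < nsize e" by (cases e) auto

lemma nat_bits_nval: "bounded_state R b s \<Longrightarrow> nat_bits (nval e s) \<le> b + nsize e"
  by (rule nat_bits_le[OF nval_bound]) (auto simp: nsize_pos)

text \<open>
  Superadditivity of \<open>p \<mapsto> p * (b + p + d)\<close>, with one unit to spare for the cost \<open>z\<close> of the operation
  at the root of an expression.
\<close>
lemma split_bound:
  fixes p q b d :: nat
  assumes "x \<le> p * (b + p + d)" "y \<le> q * (b + q + d)" "z \<le> b + p + q + 1 + d"
  shows "x + y + z \<le> (1 + p + q) * (b + (1 + p + q) + d)"
proof -
  have "p * (b + p + d) \<le> p * (b + (1 + p + q) + d)" "q * (b + q + d) \<le> q * (b + (1 + p + q) + d)"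
    by (intro mult_le_mono; simp)+
  moreover have "(1 + p + q) * (b + (1 + p + q) + d) =
    (b + p + q + 1 + d) + p * (b + (1 + p + q) + d) + q * (b + (1 + p + q) + d)"
    by (simp add: algebra_simps)
  ultimately show ?thesis using assms by linarith
qed

lemma ncost_bound:
  assumes "bounded_state R b s"
  shows "ncost e s \<le> nsize e * (b + nsize e)"
proof (induction e)
  case (NC c)
  have "c < 2 ^ (1 + c)" by (rule less_le_trans[OF less_exp]) simp
  then have "nat_bits c \<le> 1 + c" by (rule nat_bits_le) simp
  then show ?case by (simp add: algebra_simps)
next
  case (NM a e)
  then show ?case using split_bound[of "ncost e s" "nsize e" b 0 0 0] nat_bits_nval[OF assms, of "NM a e"]
    by simp
next
  case (NPlus e f)
  then show ?case using split_bound[of "ncost e s" "nsize e" b 0] nat_bits_nval[OF assms, of "NPlus e f"]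
    by (simp add: algebra_simps)
next
  case (NMinus e f)
  then show ?case using split_bound[of "ncost e s" "nsize e" b 0] nat_bits_nval[OF assms, of "NMinus e f"]
    by (simp add: algebra_simps)
qed

lemma rval_bound:
  assumes "size_model sz R d" "bounded_state R b s" "rzero e"
  shows "rval e s \<in> R (b + rsize e)"
  using assms(3)
proof (induction e)
  case (RC c)
  then show ?case by (simp add: size_modelD(2)[OF assms(1)])
next
  case (RM a e)
  have "rval (RM a e) s \<in> R b" using assms(2) by (simp add: bounded_state_def)
  then show ?case by (rule size_modelD(1)[OF assms(1), rotated]) simp
next
  case (RPlus e f)
  then have "rval e s \<in> R (b + rsize e + rsize f)" "rval f s \<in> R (b + rsize e + rsize f)"
    by (auto intro: size_modelD(1)[OF assms(1), rotated])
  from size_modelD(3)[OF assms(1) this] show ?case by (simp add: add.assoc)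
next
  case (RMinus e f)
  then have "rval e s \<in> R (b + rsize e + rsize f)" "rval f s \<in> R (b + rsize e + rsize f)"
    by (auto intro: size_modelD(1)[OF assms(1), rotated])
  from size_modelD(4)[OF assms(1) this] show ?case by (simp add: add.assoc)
qed

lemma rcost_bound:
  assumes "size_model sz R d" "bounded_state R b s" "rzero e"
  shows "rcost sz e s \<le> rsize e * (b + rsize e + d)"
  using assms(3)
proof (induction e)
  case (RC c)
  then show ?case using size_modelD(5)[OF assms(1) size_modelD(2)[OF assms(1)], of b] by simp
next
  case (RM a e)
  have "ncost e s \<le> nsize e * (b + nsize e + d)"
    by (rule order_trans[OF ncost_bound[OF assms(2)]]) simp
  moreover have "sz (rval (RM a e) s) \<le> b + d"
    using assms(2) by (auto simp: bounded_state_def intro: size_modelD(5)[OF assms(1)])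
  ultimately show ?case using split_bound[of "ncost e s" "nsize e" b d 0 0 "sz (rval (RM a e) s)"] by simp
next
  case (RPlus e f)
  then show ?case
    using split_bound[of "rcost sz e s" "rsize e" b d "rcost sz f s" "rsize f" "sz (rval (RPlus e f) s)"]
      size_modelD(5)[OF assms(1) rval_bound[OF assms(1,2) RPlus.prems]] by simp
next
  case (RMinus e f)
  then show ?case
    using split_bound[of "rcost sz e s" "rsize e" b d "rcost sz f s" "rsize f" "sz (rval (RMinus e f) s)"]
      size_modelD(5)[OF assms(1) rval_bound[OF assms(1,2) RMinus.prems]] by simp
qed

lemma ncost_bound_add: "bounded_state R b s \<Longrightarrow> ncost e s \<le> nsize e * (b + nsize e + d)"
  by (rule order_trans[OF ncost_bound], assumption) (intro mult_le_mono; simp)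

lemma bcost_bound:
  assumes "size_model sz R d" "bounded_state R b s" "bzero e"
  shows "bcost sz e s \<le> bsize e * (b + bsize e + d)"
  using assms(3)
proof (induction e)
  case (NLess e f)
  then show ?case
    using split_bound[OF ncost_bound_add[OF assms(2), of e d] ncost_bound_add[OF assms(2), of f d], of 1]
    by simp
next
  case (RLess e f)
  then show ?case
    using split_bound[OF rcost_bound[OF assms(1,2), of e] rcost_bound[OF assms(1,2), of f], of 1] by simp
next
  case (BNot e)
  then show ?case using split_bound[of "bcost sz e s" "bsize e" b d 0 0 1] by simp
next
  case (BAnd e f)
  then show ?case
    using split_bound[of "bcost sz e s" "bsize e" b d "bcost sz f s" "bsize f" 1] by simp
qed

text \<open>
  The number \<open>n\<close> counts unit steps.  The definition quantifies over all size models, so that one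
  verification of a program yields its cost in all of them.  Raising \<open>b\<close> to \<open>b + n\<close> in the final
  state is what makes the estimate compositional.
\<close>
definition runs :: "com \<Rightarrow> state \<Rightarrow> nat \<Rightarrow> state \<Rightarrow> bool" where
  "runs c s n s' \<longleftrightarrow> (\<forall>sz R d b. size_model sz R d \<longrightarrow> bounded_state R b s \<longrightarrow>
     (\<exists>t. exec sz c s t s' \<and> t \<le> n * (b + n + d) \<and> bounded_state R (b + n) s'))"

lemma bounded_state_mono:
  assumes "size_model sz R d" "bounded_state R b s" "b \<le> c"
  shows "bounded_state R c s"
proof -
  have "(2::nat) ^ b \<le> 2 ^ c" using assms(3) by (rule power_increasing) simp
  then show ?thesis using assms size_modelD(1)[OF assms(1,3)]
    unfolding bounded_state_def by (meson less_le_trans)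
qed

lemma runs_mono:
  assumes "runs c s m s'" "m \<le> n"
  shows "runs c s n s'"
  unfolding runs_def
proof (intro allI impI)
  fix sz R d b assume *: "size_model sz R d" "bounded_state R b s"
  then obtain t where t: "exec sz c s t s'" "t \<le> m * (b + m + d)" "bounded_state R (b + m) s'"
    using assms(1) unfolding runs_def by blast
  have "m * (b + m + d) \<le> n * (b + n + d)" using assms(2) by (intro mult_le_mono) auto
  with t show "\<exists>t. exec sz c s t s' \<and> t \<le> n * (b + n + d) \<and> bounded_state R (b + n) s'"
    using bounded_state_mono[OF *(1) t(3), of "b + n"] assms(2) by (meson add_left_mono order_trans)
qed

lemma runs_Skip: "runs Skip s 1 s"
  unfolding runs_def using exec.Skip bounded_state_mono by fastforce

lemma runs_NAssign:
  "runs (NAssign a e f) s (1 + nsize e + nsize f) (nstore a (nval e s) (nval f s) s)"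
  unfolding runs_def
proof (intro allI impI)
  fix sz R d b assume *: "size_model sz R d" "bounded_state R b s"
  let ?n = "1 + nsize e + nsize f"
  have "1 + ncost e s + ncost f s \<le> ?n * (b + ?n + d)"
    using split_bound[OF ncost_bound_add[OF *(2), of e d] ncost_bound_add[OF *(2), of f d], of 1] by simp
  moreover have "bounded_state R (b + ?n) (nstore a (nval e s) (nval f s) s)"
  proof -
    have "nval f s < 2 ^ (b + nsize f)" by (rule nval_bound[OF *(2)])
    also have "(2::nat) ^ (b + nsize f) \<le> 2 ^ (b + ?n)" by (rule power_increasing) auto
    finally show ?thesis using bounded_state_mono[OF *, of "b + ?n"]
      by (auto simp: bounded_state_def nstore_def)
  qed
  ultimately show "\<exists>t. exec sz (NAssign a e f) s t (nstore a (nval e s) (nval f s) s) \<and>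
      t \<le> ?n * (b + ?n + d) \<and> bounded_state R (b + ?n) (nstore a (nval e s) (nval f s) s)"
    using exec.NAssign by blast
qed

lemma runs_RAssign:
  assumes "rzero f"
  shows "runs (RAssign a e f) s (1 + nsize e + rsize f) (rstore a (nval e s) (rval f s) s)"
  unfolding runs_def
proof (intro allI impI)
  fix sz R d b assume *: "size_model sz R d" "bounded_state R b s"
  let ?n = "1 + nsize e + rsize f"
  have "1 + ncost e s + rcost sz f s \<le> ?n * (b + ?n + d)"
    using split_bound[OF ncost_bound_add[OF *(2), of e d] rcost_bound[OF * assms], of 1] by simp
  moreover have "bounded_state R (b + ?n) (rstore a (nval e s) (rval f s) s)"
  proof -
    have "rval f s \<in> R (b + ?n)"
      by (rule size_modelD(1)[OF *(1) _ rval_bound[OF * assms]]) simp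
    then show ?thesis using bounded_state_mono[OF *, of "b + ?n"]
      by (auto simp: bounded_state_def rstore_def)
  qed
  ultimately show "\<exists>t. exec sz (RAssign a e f) s t (rstore a (nval e s) (rval f s) s) \<and>
      t \<le> ?n * (b + ?n + d) \<and> bounded_state R (b + ?n) (rstore a (nval e s) (rval f s) s)"
    using exec.RAssign by blast
qed

lemma add_cost:
  fixes m n b d :: nat
  assumes "t \<le> m * (b + m + d)" "u \<le> n * (b + m + n + d)"
  shows "t + u \<le> (m + n) * (b + (m + n) + d)"
proof -
  have "m * (b + m + d) \<le> m * (b + (m + n) + d)" by (intro mult_le_mono) auto
  with assms show ?thesis by (simp add: algebra_simps)
qed

lemma runs_Seq:
  assumes "runs c s m s'" "runs d s' n s''"
  shows "runs (Seq c d) s (m + n) s''"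
  unfolding runs_def
proof (intro allI impI)
  fix sz R e b assume *: "size_model sz R e" "bounded_state R b s"
  then obtain t where t: "exec sz c s t s'" "t \<le> m * (b + m + e)" "bounded_state R (b + m) s'"
    using assms(1) unfolding runs_def by blast
  then obtain u where u: "exec sz d s' u s''" "u \<le> n * (b + m + n + e)" "bounded_state R (b + m + n) s''"
    using assms(2) *(1) unfolding runs_def by blast
  show "\<exists>t. exec sz (Seq c d) s t s'' \<and> t \<le> (m + n) * (b + (m + n) + e) \<and> bounded_state R (b + (m + n)) s''"
    using exec.Seq[OF t(1) u(1)] add_cost[OF t(2) u(2)] u(3) by (auto simp: add.assoc)
qed

lemma runs_test:
  assumes "bzero e" "runs c s n s'" and "\<And>sz t. exec sz c s t s' \<Longrightarrow> exec sz d s (bcost sz e s + t) s'"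
  shows "runs d s (bsize e + n) s'"
  unfolding runs_def
proof (intro allI impI)
  fix sz R k b assume *: "size_model sz R k" "bounded_state R b s"
  then obtain t where t: "exec sz c s t s'" "t \<le> n * (b + n + k)" "bounded_state R (b + n) s'"
    using assms(2) unfolding runs_def by blast
  have "n * (b + n + k) \<le> n * (b + bsize e + n + k)" by (intro mult_le_mono) auto
  with t(2) have "t \<le> n * (b + bsize e + n + k)" by (rule order_trans)
  from add_cost[OF bcost_bound[OF * assms(1)] this]
  show "\<exists>t. exec sz d s t s' \<and> t \<le> (bsize e + n) * (b + (bsize e + n) + k) \<and>
      bounded_state R (b + (bsize e + n)) s'"
    using assms(3)[OF t(1)] bounded_state_mono[OF *(1) t(3), of "b + (bsize e + n)"] by auto
qed

lemma runs_Cond: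
  assumes "bzero e" "runs (if bval e s then c else d) s n s'"
  shows "runs (Cond e c d) s (bsize e + n) s'"
  by (rule runs_test[OF assms]) (auto split: if_splits intro: exec.CondTrue exec.CondFalse)

lemma runs_While_False:
  assumes "bzero e" "\<not> bval e s"
  shows "runs (While e c) s (bsize e) s"
  unfolding runs_def using bcost_bound[OF _ _ assms(1)] exec.WhileFalse[OF assms(2)]
  by (meson bounded_state_mono le_add1)

lemma runs_While_True:
  assumes "bzero e" "bval e s" "runs c s m s'" "runs (While e c) s' n s''"
  shows "runs (While e c) s (bsize e + (m + n)) s''"
proof (rule runs_test[OF assms(1) runs_Seq[OF assms(3,4)]])
  fix sz t assume "exec sz (Seq c (While e c)) s t s''"
  then show "exec sz (While e c) s (bcost sz e s + t) s''"
    by (cases rule: exec.cases) (use exec.WhileTrue[OF assms(2)] in \<open>auto simp: add.assoc\<close>)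
qed

text \<open>
  A weakest-precondition form of \<open>runs\<close>: programs are verified backwards, together with a bound on
  the number of steps.
\<close>
definition reach :: "com \<Rightarrow> state \<Rightarrow> nat \<Rightarrow> (state \<Rightarrow> bool) \<Rightarrow> bool" where
  "reach c s n Q \<longleftrightarrow> (\<exists>s'. runs c s n s' \<and> Q s')"

lemma reach_mono:
  "reach c s m P \<Longrightarrow> m \<le> n \<Longrightarrow> (\<And>s'. P s' \<Longrightarrow> Q s') \<Longrightarrow> reach c s n Q"
  unfolding reach_def using runs_mono by blast

lemma reach_Seq:
  "reach c s m P \<Longrightarrow> (\<And>s'. P s' \<Longrightarrow> reach d s' n Q) \<Longrightarrow> reach (Seq c d) s (m + n) Q"
  unfolding reach_def using runs_Seq by blast

lemma reach_Cond:
  assumes "bzero e" "bval e s \<Longrightarrow> reach c s n Q" "\<not> bval e s \<Longrightarrow> reach d s n Q"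
  shows "reach (Cond e c d) s (bsize e + n) Q"
proof -
  obtain s' where "runs (if bval e s then c else d) s n s'" "Q s'"
    using assms(2,3) unfolding reach_def by (cases "bval e s") auto
  then show ?thesis using runs_Cond[OF assms(1)] unfolding reach_def by blast
qed

text \<open>
  Loop-free code is verified by symbolic execution: \<open>effect\<close> is a function that the simplifier
  evaluates.
\<close>
fun straight :: "com \<Rightarrow> bool" where
  "straight Skip \<longleftrightarrow> True"
| "straight (NAssign a e f) \<longleftrightarrow> True"
| "straight (RAssign a e f) \<longleftrightarrow> rzero f"
| "straight (Seq c d) \<longleftrightarrow> straight c \<and> straight d"
| "straight (Cond b c d) \<longleftrightarrow> bzero b \<and> straight c \<and> straight d"
| "straight (While b c) \<longleftrightarrow> False"

fun effect :: "com \<Rightarrow> state \<Rightarrow> state" where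
  "effect (NAssign a e f) s = nstore a (nval e s) (nval f s) s"
| "effect (RAssign a e f) s = rstore a (nval e s) (rval f s) s"
| "effect (Seq c d) s = effect d (effect c s)"
| "effect (Cond b c d) s = (if bval b s then effect c s else effect d s)"
| "effect _ s = s"

fun csize :: "com \<Rightarrow> nat" where
  "csize Skip = 1"
| "csize (NAssign a e f) = 1 + nsize e + nsize f"
| "csize (RAssign a e f) = 1 + nsize e + rsize f"
| "csize (Seq c d) = csize c + csize d"
| "csize (Cond b c d) = bsize b + (csize c + csize d)"
| "csize (While b c) = bsize b + csize c"

lemma runs_straight: "straight c \<Longrightarrow> runs c s (csize c) (effect c s)"
proof (induction c arbitrary: s)
  case (Cond b c d)
  then have "runs c s (csize c + csize d) (effect c s)" "runs d s (csize c + csize d) (effect d s)"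
    using runs_mono[of c s "csize c"] runs_mono[of d s "csize d"] by simp_all
  then show ?case using Cond.prems runs_Cond[of b s c d "csize c + csize d"] by simp
qed (auto intro: runs_Skip[simplified] runs_NAssign[simplified] runs_RAssign[simplified] runs_Seq)

lemma reach_straight: "straight c \<Longrightarrow> Q (effect c s) \<Longrightarrow> reach c s (csize c) Q"
  unfolding reach_def using runs_straight by blast

definition For :: "nat \<Rightarrow> nexp \<Rightarrow> com \<Rightarrow> com" where
  "For i e c = Seq (NAssign i (NC 0) (NC 0))
     (While (NLess (NM i (NC 0)) e) (Seq c (NAssign i (NC 0) (NPlus (NM i (NC 0)) (NC 1)))))"

text \<open>
  The invariant is required after the counter has been increased, so it need not mention the counter,
  whose value is supplied separately.
\<close>
lemma reach_For:
  assumes init: "I 0 (nstore i 0 0 s)"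
    and bound: "\<And>j s. I j s \<Longrightarrow> nmem s i 0 = j \<Longrightarrow> nval e s = N"
    and step: "\<And>j s. j < N \<Longrightarrow> I j s \<Longrightarrow> nmem s i 0 = j \<Longrightarrow>
      reach c s T (\<lambda>s'. nmem s' i 0 = j \<and> I (Suc j) (nstore i 0 (Suc j) s'))"
    and final: "\<And>s. I N s \<Longrightarrow> nmem s i 0 = N \<Longrightarrow> Q s"
  shows "reach (For i e c) s ((N + 1) * (T + nsize e + 13)) Q"
proof -
  let ?b = "NLess (NM i (NC 0)) e"
  let ?inc = "NAssign i (NC 0) (NPlus (NM i (NC 0)) (NC 1))"
  let ?W = "While ?b (Seq c ?inc)"
  have loop: "reach ?W s ((3 + nsize e) * (r + 1) + r * (T + 7)) Q"
    if "I j s" "nmem s i 0 = j" "j + r = N" for j r s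
    using that
  proof (induction r arbitrary: j s)
    case 0
    then have "runs ?W s (bsize ?b) s"
      using bound[of j s] by (intro runs_While_False) auto
    then have "runs ?W s (3 + nsize e) s" by (rule runs_mono) simp
    moreover have "Q s" using 0 final by simp
    ultimately show ?case by (auto simp: reach_def)
  next
    case (Suc r)
    then have "j < N" by simp
    from step[OF this Suc.prems(1,2)] obtain s' where s': "runs c s T s'" "nmem s' i 0 = j"
      "I (Suc j) (nstore i 0 (Suc j) s')" by (auto simp: reach_def)
    have "runs ?inc s' 7 (nstore i 0 (Suc j) s')"
      using runs_NAssign[of i "NC 0" "NPlus (NM i (NC 0)) (NC 1)" s'] s'(2) by (simp add: numeral_eq_Suc)
    then have "runs (Seq c ?inc) s (T + 7) (nstore i 0 (Suc j) s')"
      using runs_Seq[OF s'(1)] by blast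
    moreover obtain s'' where "runs ?W (nstore i 0 (Suc j) s') ((3 + nsize e) * (r + 1) + r * (T + 7)) s''" "Q s''"
      using Suc.IH[OF s'(3)] Suc.prems(3) by (auto simp: reach_def nstore_def)
    ultimately have "runs ?W s (bsize ?b + (T + 7 + ((3 + nsize e) * (r + 1) + r * (T + 7)))) s''"
      using bound[OF Suc.prems(1,2)] \<open>j < N\<close> Suc.prems(2) by (intro runs_While_True) auto
    then have "runs ?W s ((3 + nsize e) * (Suc r + 1) + Suc r * (T + 7)) s''"
      by (rule runs_mono) (simp add: algebra_simps)
    with \<open>Q s''\<close> show ?case by (auto simp: reach_def)
  qed
  have init_step: "reach (NAssign i (NC 0) (NC 0)) s 3 (\<lambda>s'. s' = nstore i 0 0 s)"
    using runs_NAssign[of i "NC 0" "NC 0" s] by (auto simp: reach_def numeral_3_eq_3)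
  have "reach ?W (nstore i 0 0 s) ((3 + nsize e) * (N + 1) + N * (T + 7)) Q"
    using loop[OF init, of N] by (simp add: nstore_def)
  then have "reach (For i e c) s (3 + ((3 + nsize e) * (N + 1) + N * (T + 7))) Q"
    unfolding For_def by (intro reach_Seq[OF init_step]) simp
  then show ?thesis by (rule reach_mono) (simp_all add: algebra_simps)
qed

section \<open>From unit steps to polynomial time\<close>

text \<open>
  The length of the input words, not their size, bounds the number of steps; it is the quantity that
  both cost models share.
\<close>
lemma poly_time_in_size_model:
  fixes C e :: nat
  assumes model: "\<And>x. x \<in> D \<Longrightarrow> \<exists>R d. size_model sz R d \<and> d \<le> input_size sz (enc x) + 3 \<and>
      bounded_state R (input_size sz (enc x)) (load (enc x))"
    and pos: "\<And>y. 1 \<le> sz y"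
    and run: "\<And>x. x \<in> D \<Longrightarrow>
      reach c (load (enc x)) (C * (length (fst (enc x)) + length (snd (enc x)) + 2) ^ e) (ok x)"
  shows "solves_in_poly_time sz c D enc ok"
proof -
  define q :: "nat poly" where "q = smult C ([:2, 1:] ^ e)"
  define p :: "nat poly" where "p = q * ([:3, 2:] + q)"
  have "\<exists>t s'. exec sz c (load (enc x)) t s' \<and> t \<le> poly p (input_size sz (enc x)) \<and> ok x s'"
    if x: "x \<in> D" for x
  proof -
    let ?n = "input_size sz (enc x)"
    let ?T = "C * (length (fst (enc x)) + length (snd (enc x)) + 2) ^ e"
    obtain R d where R: "size_model sz R d" "d \<le> ?n + 3" "bounded_state R ?n (load (enc x))"
      using model[OF x] by blast
    obtain s' where s': "runs c (load (enc x)) ?T s'" "ok x s'" using run[OF x] by (auto simp: reach_def)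
    then obtain t where t: "exec sz c (load (enc x)) t s'" "t \<le> ?T * (?n + ?T + d)"
      using R unfolding runs_def by blast
    have "length xs \<le> sum_list (map nat_bits xs)" for xs
      by (induction xs) (auto simp: nat_bits_def)
    moreover have "length ys \<le> sum_list (map sz ys)" for ys
    proof (induction ys)
      case (Cons y ys)
      with pos[of y] show ?case by simp
    qed simp
    ultimately have "length (fst (enc x)) + length (snd (enc x)) \<le> ?n"
      unfolding input_size_def by (meson add_mono)
    then have "?T \<le> C * (?n + 2) ^ e" by (intro mult_le_mono2 power_mono) auto
    then have T: "?T \<le> poly q ?n" by (simp add: q_def poly_power add.commute)
    have "?T * (?n + ?T + d) \<le> poly q ?n * (3 + 2 * ?n + poly q ?n)"
      by (rule mult_le_mono) (use T R(2) in auto)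
    also have "\<dots> = poly p ?n" by (simp add: p_def algebra_simps)
    finally show ?thesis using t s'(2) by (meson order_trans)
  qed
  then show ?thesis unfolding solves_in_poly_time_def by blast
qed

lemma bounded_load:
  assumes "size_model sz R d" "set (snd w) \<subseteq> R (input_size sz' w)"
  shows "bounded_state R (input_size sz' w) (load w)"
proof -
  have "x < 2 ^ input_size sz' w" if "x \<in> set (fst w)" for x
  proof -
    have "floorlog 2 x \<le> nat_bits x" by (simp add: nat_bits_def)
    also have "\<dots> \<le> sum_list (map nat_bits (fst w))" using that by (intro member_le_sum_list) auto
    also have "\<dots> \<le> input_size sz' w" by (simp add: input_size_def)
    finally show ?thesis by (rule floorlog_leD) simp
  qed
  then show ?thesis
    using assms(2) size_modelD(2)[OF assms(1)] nth_mem unfolding bounded_state_def load_def by auto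
qed

lemma size_model_unit: "size_model (\<lambda>_. 1) (\<lambda>_. UNIV) 1"
  by (simp add: size_model_def mono_def)

lemma rat_bits_of_rat:
  "rat_bits (real_of_rat r) =
    1 + nat_bits (nat \<bar>fst (quotient_of r)\<bar>) + nat_bits (nat (snd (quotient_of r)))"
proof -
  have "(THE s. real_of_rat s = real_of_rat r) = r" by (rule the_equality) auto
  then show ?thesis by (simp add: rat_bits_def Let_def split: prod.split)
qed

lemma less_two_power_nat_bits: "x < 2 ^ nat_bits x"
  by (rule floorlog_leD) (simp_all add: nat_bits_def)

definition fractions :: "int \<Rightarrow> nat \<Rightarrow> real set" where
  "fractions N b = {of_int p / of_int N | p. \<bar>p\<bar> \<le> 2 ^ b}"

text \<open>
  The product of the denominators.  Its length, and the lengths of all numerators after expansion, are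
  at most the sum of the lengths of the given numbers.
\<close>
lemma common_denominator:
  assumes "set ys \<subseteq> \<rat>"
  shows "\<exists>N. 0 < N \<and> N \<le> 2 ^ sum_list (map rat_bits ys) \<and>
    set ys \<subseteq> fractions N (sum_list (map rat_bits ys))"
  using assms
proof (induction ys)
  case (Cons y ys)
  let ?S = "sum_list (map rat_bits ys)"
  obtain N where N: "0 < N" "N \<le> 2 ^ ?S" "set ys \<subseteq> fractions N ?S" using Cons by auto
  obtain r where r: "y = real_of_rat r" using Cons.prems by (auto elim: Rats_cases)
  obtain p q where pq: "quotient_of r = (p, q)" by fastforce
  have q: "0 < q" using quotient_of_denom_pos[OF pq] .
  define a where "a = nat_bits (nat \<bar>p\<bar>)"
  define b where "b = nat_bits (nat q)"
  have y: "rat_bits y = 1 + a + b" by (simp add: r rat_bits_of_rat pq a_def b_def)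
  have "nat \<bar>p\<bar> < 2 ^ a" "nat q < 2 ^ b" by (simp_all add: a_def b_def less_two_power_nat_bits)
  then have pa: "\<bar>p\<bar> \<le> 2 ^ a" and qb: "q \<le> 2 ^ b" by (simp_all add: nat_less_iff)
  have bound: "x * z \<le> 2 ^ (rat_bits y + ?S)"
    if "0 \<le> x" "x \<le> 2 ^ i" "0 \<le> z" "z \<le> 2 ^ ?S" "i \<le> rat_bits y" for x z :: int and i
  proof -
    have "x * z \<le> 2 ^ i * 2 ^ ?S" using that by (intro mult_mono) auto
    also have "\<dots> = 2 ^ (i + ?S)" by (simp add: power_add)
    also have "\<dots> \<le> (2::int) ^ (rat_bits y + ?S)" by (rule power_increasing) (use that(5) in auto)
    finally show ?thesis .
  qed
  have "q * N \<le> 2 ^ (rat_bits y + ?S)" by (rule bound[of _ b]) (use q qb N y in auto)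
  moreover have "y \<in> fractions (q * N) (rat_bits y + ?S)"
  proof -
    have "\<bar>p * N\<bar> \<le> 2 ^ (rat_bits y + ?S)"
      using bound[of "\<bar>p\<bar>" a N] pa N y by (simp add: abs_mult)
    moreover have "y = of_int (p * N) / of_int (q * N)"
      using quotient_of_div[OF pq] N(1) by (simp add: r of_rat_divide)
    ultimately show ?thesis unfolding fractions_def by blast
  qed
  moreover have "set ys \<subseteq> fractions (q * N) (rat_bits y + ?S)"
  proof
    fix x assume "x \<in> set ys"
    then obtain p' where p': "x = of_int p' / of_int N" "\<bar>p'\<bar> \<le> 2 ^ ?S"
      using N(3) by (auto simp: fractions_def)
    have "\<bar>q * p'\<bar> \<le> 2 ^ (rat_bits y + ?S)"
      using bound[of q b "\<bar>p'\<bar>"] q qb p'(2) y by (simp add: abs_mult)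
    moreover have "x = of_int (q * p') / of_int (q * N)" using p'(1) q by simp
    ultimately show "x \<in> fractions (q * N) (rat_bits y + ?S)" unfolding fractions_def by blast
  qed
  moreover have "0 < q * N" using q N by simp
  ultimately show ?case by auto
qed (auto intro: exI[of _ 1])

text \<open>
  Lengths are taken in lowest terms, and cancelling makes numerator and denominator smaller.
\<close>
lemma size_model_rat:
  assumes N: "0 < N" "N \<le> 2 ^ c"
  shows "size_model rat_bits (fractions N) (c + 3)"
proof -
  have "fractions N b \<subseteq> fractions N b'" if "b \<le> b'" for b b'
  proof -
    have "(2::int) ^ b \<le> 2 ^ b'" using that by (rule power_increasing) simp
    then have "\<bar>p\<bar> \<le> 2 ^ b \<Longrightarrow> \<bar>p\<bar> \<le> 2 ^ b'" for p :: int by (rule order_trans[rotated])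
    then show ?thesis unfolding fractions_def by blast
  qed
  moreover have "0 \<in> fractions N b" for b by (auto simp: fractions_def intro: exI[of _ 0])
  moreover have "x + y \<in> fractions N (Suc b) \<and> x - y \<in> fractions N (Suc b)"
    if xy: "x \<in> fractions N b" "y \<in> fractions N b" for b x y
  proof -
    obtain p q where p: "x = of_int p / of_int N" "\<bar>p\<bar> \<le> 2 ^ b" and q: "y = of_int q / of_int N" "\<bar>q\<bar> \<le> 2 ^ b"
      using xy by (auto simp: fractions_def)
    have "x + y = of_int (p + q) / of_int N" "x - y = of_int (p - q) / of_int N"
      by (simp_all add: p q add_divide_distrib diff_divide_distrib)
    moreover have "\<bar>p + q\<bar> \<le> 2 ^ Suc b" "\<bar>p - q\<bar> \<le> 2 ^ Suc b" using p(2) q(2) by auto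
    ultimately show ?thesis unfolding fractions_def by blast
  qed
  moreover have "rat_bits x \<le> b + (c + 3)" if x: "x \<in> fractions N b" for b x
  proof -
    obtain p where p: "x = of_int p / of_int N" "\<bar>p\<bar> \<le> 2 ^ b" using x by (auto simp: fractions_def)
    define g where "g = gcd p N"
    have g: "0 < g" using N(1) by (simp add: g_def gcd_pos_int)
    have x: "x = real_of_rat (Fract p N)" using N(1) by (simp add: p(1) of_rat_rat)
    have quot: "quotient_of (Fract p N) = (p div g, N div g)"
      using N(1) by (simp add: quotient_of_Fract normalize_def g_def Let_def)
    have div_le: "\<bar>x div g\<bar> \<le> \<bar>x\<bar>" if "g dvd x" for x
    proof -
      obtain y where y: "x = g * y" using \<open>g dvd x\<close> ..
      have "1 * \<bar>y\<bar> \<le> g * \<bar>y\<bar>" by (rule mult_right_mono) (use g in auto)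
      then show ?thesis using g by (simp add: y abs_mult)
    qed
    have "\<bar>p div g\<bar> \<le> \<bar>p\<bar>" by (rule div_le) (simp add: g_def)
    also have "\<bar>p\<bar> < 2 ^ (b + 1)" using p(2) by (simp add: le_less_trans)
    finally have 1: "nat_bits (nat \<bar>p div g\<bar>) \<le> b + 1" by (intro nat_bits_le) (simp_all add: nat_less_iff)
    have "N div g \<le> N" using div_le[of N] N(1) by (simp add: g_def)
    also have "N < 2 ^ (c + 1)" using N(2) by (simp add: le_less_trans)
    finally have 2: "nat_bits (nat (N div g)) \<le> c + 1" using g N(1)
      by (intro nat_bits_le) (simp_all add: nat_less_iff pos_imp_zdiv_nonneg_iff)
    from 1 2 show ?thesis unfolding x rat_bits_of_rat quot by simp
  qed
  ultimately show ?thesis unfolding size_model_def mono_def by blast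
qed

lemma solvable_by_reach:
  fixes C e :: nat
  assumes run: "\<And>x. x \<in> D \<Longrightarrow>
    reach c (load (enc x)) (C * (length (fst (enc x)) + length (snd (enc x)) + 2) ^ e) (ok x)"
  shows "solvable_in_polynomial_time D enc ok"
proof -
  have "solves_in_poly_time (\<lambda>_. 1) c D enc ok"
  proof (rule poly_time_in_size_model[OF _ _ run])
    fix x
    show "\<exists>R d. size_model (\<lambda>_. 1) R d \<and> d \<le> input_size (\<lambda>_. 1) (enc x) + 3 \<and>
        bounded_state R (input_size (\<lambda>_. 1) (enc x)) (load (enc x))"
      using size_model_unit bounded_load[OF size_model_unit, of "enc x" "\<lambda>_. 1"]
      by (intro exI[of _ "\<lambda>_. UNIV"] exI[of _ 1]) auto
  qed simp_all
  moreover have "solves_in_poly_time rat_bits c {x \<in> D. set (snd (enc x)) \<subseteq> \<rat>} enc ok"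
  proof (rule poly_time_in_size_model)
    fix x assume "x \<in> {x \<in> D. set (snd (enc x)) \<subseteq> \<rat>}"
    then obtain N where N: "0 < N" "N \<le> 2 ^ sum_list (map rat_bits (snd (enc x)))"
      "set (snd (enc x)) \<subseteq> fractions N (sum_list (map rat_bits (snd (enc x))))"
      using common_denominator by blast
    let ?n = "input_size rat_bits (enc x)"
    have le: "sum_list (map rat_bits (snd (enc x))) \<le> ?n" by (simp add: input_size_def)
    have "(2::int) ^ sum_list (map rat_bits (snd (enc x))) \<le> 2 ^ ?n" using le by (rule power_increasing) simp
    with N(2) have "N \<le> 2 ^ ?n" by (rule order_trans)
    with N(1) have model: "size_model rat_bits (fractions N) (?n + 3)" by (rule size_model_rat)
    have "set (snd (enc x)) \<subseteq> fractions N ?n"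
      using N(3) size_modelD(1)[OF model le] by blast
    then show "\<exists>R d. size_model rat_bits R d \<and> d \<le> ?n + 3 \<and> bounded_state R ?n (load (enc x))"
      using model bounded_load[OF model] by blast
  next
    show "1 \<le> rat_bits y" for y by (simp add: rat_bits_def Let_def split: prod.split)
  qed (use run in auto)
  ultimately show ?thesis unfolding solvable_in_polynomial_time_def by blast
qed

section \<open>Sweeping through precedences and forbidden intervals\<close>

text \<open>
  A precedence \<open>(u, v, t)\<close> demands \<open>G u + t \<le> G v\<close>, a window \<open>(u, lo, hi)\<close> forbids values of \<open>G u\<close>
  strictly between \<open>lo\<close> and \<open>hi\<close>.  The second component of a pair \<open>(G, f)\<close> is a flag, set to 0
  when a repair takes place.
\<close>
type_synonym precedence = "nat \<times> nat \<times> real"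
type_synonym window = "nat \<times> real \<times> real"

fun relax_prec :: "precedence \<Rightarrow> (nat \<Rightarrow> real) \<times> nat \<Rightarrow> (nat \<Rightarrow> real) \<times> nat" where
  "relax_prec (u, v, t) (G, f) = (if G v < G u + t then (G(v := G u + t), 0) else (G, f))"

fun relax_window :: "window \<Rightarrow> (nat \<Rightarrow> real) \<times> nat \<Rightarrow> (nat \<Rightarrow> real) \<times> nat" where
  "relax_window (u, lo, hi) (G, f) = (if lo < G u \<and> G u < hi then (G(u := hi), 0) else (G, f))"

definition sweep :: "precedence list \<Rightarrow> window list \<Rightarrow> (nat \<Rightarrow> real) \<times> nat \<Rightarrow> (nat \<Rightarrow> real) \<times> nat" where
  "sweep As Bs p = fold relax_window Bs (fold relax_prec As (fst p, 1))"

definition sat_prec :: "(nat \<Rightarrow> real) \<Rightarrow> precedence \<Rightarrow> bool" where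
  "sat_prec G = (\<lambda>(u, v, t). G u + t \<le> G v)"

definition sat_window :: "(nat \<Rightarrow> real) \<Rightarrow> window \<Rightarrow> bool" where
  "sat_window G = (\<lambda>(u, lo, hi). G u \<le> lo \<or> hi \<le> G u)"

definition schedule :: "precedence list \<Rightarrow> window list \<Rightarrow> (nat \<Rightarrow> real) \<Rightarrow> bool" where
  "schedule As Bs G \<longleftrightarrow> (\<forall>i. 0 \<le> G i) \<and> (\<forall>x\<in>set As. sat_prec G x) \<and> (\<forall>x\<in>set Bs. sat_window G x)"

lemma relax_prec_mono: "fst p i \<le> fst (relax_prec x p) i"
  by (cases x; cases p) auto

lemma relax_window_mono: "fst p i \<le> fst (relax_window x p) i"
  by (cases x; cases p) auto

lemma fold_relax_prec_mono: "fst p i \<le> fst (fold relax_prec xs p) i"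
proof (induction xs arbitrary: p)
  case (Cons x xs)
  then show ?case using order_trans[OF relax_prec_mono[of p i x]] by simp
qed simp

lemma fold_relax_window_mono: "fst p i \<le> fst (fold relax_window xs p) i"
proof (induction xs arbitrary: p)
  case (Cons x xs)
  then show ?case using order_trans[OF relax_window_mono[of p i x]] by simp
qed simp

lemma sweep_mono: "fst p i \<le> fst (sweep As Bs p) i"
  unfolding sweep_def by (rule order_trans[OF _ fold_relax_window_mono])
    (use fold_relax_prec_mono[of "(fst p, 1)"] in simp)

lemma fold_relax_prec_le:
  "\<lbrakk>\<forall>x\<in>set xs. sat_prec H x; \<forall>i. fst p i \<le> H i\<rbrakk> \<Longrightarrow> fst (fold relax_prec xs p) i \<le> H i"
proof (induction xs arbitrary: p)
  case (Cons x xs)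
  obtain u v t where x: "x = (u, v, t)" by (cases x)
  obtain G f where p: "p = (G, f)" by (cases p)
  have "H u + t \<le> H v" "G u \<le> H u" using Cons.prems by (simp_all add: x p sat_prec_def)
  then have "G u + t \<le> H v" by linarith
  then have "\<forall>i. fst (relax_prec x p) i \<le> H i" using Cons.prems(2) by (simp add: x p)
  then show ?case using Cons.IH Cons.prems(1) by simp
qed simp

lemma fold_relax_window_le:
  "\<lbrakk>\<forall>x\<in>set xs. sat_window H x; \<forall>i. fst p i \<le> H i\<rbrakk> \<Longrightarrow> fst (fold relax_window xs p) i \<le> H i"
proof (induction xs arbitrary: p)
  case (Cons x xs)
  obtain u lo hi where x: "x = (u, lo, hi)" by (cases x)
  obtain G f where p: "p = (G, f)" by (cases p)
  have "H u \<le> lo \<or> hi \<le> H u" "G u \<le> H u" using Cons.prems by (simp_all add: x p sat_window_def)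
  then have "lo < G u \<Longrightarrow> hi \<le> H u" by linarith
  then have "\<forall>i. fst (relax_window x p) i \<le> H i" using Cons.prems(2) by (simp add: x p)
  then show ?case using Cons.IH Cons.prems(1) by simp
qed simp

lemma sweep_le:
  assumes "schedule As Bs H" "\<forall>i. fst p i \<le> H i"
  shows "fst (sweep As Bs p) i \<le> H i"
  unfolding sweep_def using assms
  by (intro fold_relax_window_le allI fold_relax_prec_le) (auto simp: schedule_def)

lemma fold_relax_prec_reaches:
  "(u, v, t) \<in> set xs \<Longrightarrow> fst p u + t \<le> fst (fold relax_prec xs p) v"
proof (induction xs arbitrary: p)
  case (Cons x xs)
  show ?case
  proof (cases "x = (u, v, t)")
    case True
    obtain G f where p: "p = (G, f)" by (cases p)
    have "fst p u + t \<le> fst (relax_prec x p) v" by (simp add: True p)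
    also have "\<dots> \<le> fst (fold relax_prec xs (relax_prec x p)) v" by (rule fold_relax_prec_mono)
    finally show ?thesis by simp
  next
    case False
    then have "fst (relax_prec x p) u + t \<le> fst (fold relax_prec xs (relax_prec x p)) v"
      using Cons by simp
    then show ?thesis using relax_prec_mono[of p u x] by simp
  qed
qed simp

lemma fold_relax_window_reaches:
  "(u, lo, hi) \<in> set xs \<Longrightarrow> lo < fst p u \<Longrightarrow> hi \<le> fst (fold relax_window xs p) u"
proof (induction xs arbitrary: p)
  case (Cons x xs)
  show ?case
  proof (cases "x = (u, lo, hi)")
    case True
    obtain G f where p: "p = (G, f)" by (cases p)
    have "hi \<le> fst (relax_window x p) u" using Cons.prems by (simp add: True p)
    also have "\<dots> \<le> fst (fold relax_window xs (relax_window x p)) u" by (rule fold_relax_window_mono)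
    finally show ?thesis by simp
  next
    case False
    have "lo < fst (relax_window x p) u" using Cons.prems(2) relax_window_mono[of p u x] by simp
    with False show ?thesis using Cons by simp
  qed
qed simp

lemma fold_relax_prec_flag:
  "fold relax_prec xs (G, f) = (G', f') \<Longrightarrow>
    (if \<forall>x\<in>set xs. sat_prec G x then G' = G \<and> f' = f else f' = 0)"
proof (induction xs arbitrary: G f)
  case (Cons x xs)
  obtain u v t where x: "x = (u, v, t)" by (cases x)
  have zero: "fold relax_prec ys (H, 0) = (G', f') \<Longrightarrow> f' = 0" for ys H
    by (induction ys arbitrary: H) (auto split: if_splits)
  show ?case using Cons zero by (auto simp: x sat_prec_def split: if_splits)
qed simp

lemma fold_relax_window_flag:
  "fold relax_window xs (G, f) = (G', f') \<Longrightarrow>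
    (if \<forall>x\<in>set xs. sat_window G x then G' = G \<and> f' = f else f' = 0)"
proof (induction xs arbitrary: G f)
  case (Cons x xs)
  obtain u lo hi where x: "x = (u, lo, hi)" by (cases x)
  have zero: "fold relax_window ys (H, 0) = (G', f') \<Longrightarrow> f' = 0" for ys H
    by (induction ys arbitrary: H) (auto split: if_splits)
  show ?case using Cons zero by (auto simp: x sat_window_def split: if_splits)
qed simp

lemma sweep_flag:
  assumes "sweep As Bs (G, f) = (G', f')"
  shows "if (\<forall>x\<in>set As. sat_prec G x) \<and> (\<forall>x\<in>set Bs. sat_window G x) then G' = G \<and> f' = 1 else f' = 0"
proof -
  obtain G1 f1 where 1: "fold relax_prec As (G, 1) = (G1, f1)" by fastforce
  then have 2: "fold relax_window Bs (G1, f1) = (G', f')" using assms by (simp add: sweep_def)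
  show ?thesis using fold_relax_prec_flag[OF 1] fold_relax_window_flag[OF 2] by (auto split: if_splits)
qed

definition least_schedule :: "precedence list \<Rightarrow> window list \<Rightarrow> nat \<Rightarrow> real" where
  "least_schedule As Bs i = (INF G\<in>{G. schedule As Bs G}. G i)"

lemma least_schedule_le:
  assumes "schedule As Bs H"
  shows "least_schedule As Bs i \<le> H i"
  unfolding least_schedule_def
  by (rule cINF_lower) (use assms in \<open>auto simp: schedule_def bdd_below_def\<close>)

lemma least_schedule_ge:
  assumes "schedule As Bs H" "\<And>G. schedule As Bs G \<Longrightarrow> c \<le> G i"
  shows "c \<le> least_schedule As Bs i"
  unfolding least_schedule_def by (rule cINF_greatest) (use assms in auto)

text \<open>
  For a window at \<open>u\<close>: if the infimum exceeds \<open>lo\<close>, so does every schedule, which must then be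
  at least \<open>hi\<close>.
\<close>
lemma schedule_least_schedule:
  assumes "schedule As Bs H"
  shows "schedule As Bs (least_schedule As Bs)" (is "schedule _ _ ?L")
proof -
  have "0 \<le> ?L i" for i by (rule least_schedule_ge[OF assms]) (simp add: schedule_def)
  moreover have "?L u + t \<le> ?L v" if "(u, v, t) \<in> set As" for u v t
  proof (rule least_schedule_ge[OF assms])
    fix G assume G: "schedule As Bs G"
    then have "G u + t \<le> G v" using that by (auto simp: schedule_def sat_prec_def)
    then show "?L u + t \<le> G v" using least_schedule_le[OF G, of u] by linarith
  qed
  moreover have "hi \<le> ?L u" if "(u, lo, hi) \<in> set Bs" "lo < ?L u" for u lo hi
  proof (rule least_schedule_ge[OF assms])
    fix G assume G: "schedule As Bs G"
    then have "G u \<le> lo \<or> hi \<le> G u" using that(1) by (auto simp: schedule_def sat_window_def)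
    then show "hi \<le> G u" using least_schedule_le[OF G, of u] that(2) by linarith
  qed
  ultimately show ?thesis by (force simp: schedule_def sat_prec_def sat_window_def)
qed

text \<open>
  The potential of the termination argument: no sweep decreases either summand, since values grow and
  never exceed the least schedule.
\<close>
definition progress :: "nat \<Rightarrow> precedence list \<Rightarrow> window list \<Rightarrow> (nat \<Rightarrow> real) \<Rightarrow> nat" where
  "progress N As Bs G = card {v. v < N \<and> G v = least_schedule As Bs v} +
     card {i. i < length Bs \<and> snd (snd (Bs ! i)) \<le> G (fst (Bs ! i))}"

text \<open>
  Precedences of length 0 are admitted only into vertices without outgoing precedences.  This excludes
  cycles of length 0, on which no vertex would have only final predecessors.
\<close>
definition sound_instance :: "nat \<Rightarrow> precedence list \<Rightarrow> window list \<Rightarrow> bool" where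
  "sound_instance N As Bs \<longleftrightarrow>
     (\<forall>(u, v, t)\<in>set As. u < N \<and> v < N \<and>
        (0 < t \<or> t = 0 \<and> (\<forall>(u', v', t')\<in>set As. u' \<noteq> v))) \<and>
     (\<forall>(u, lo, hi)\<in>set Bs. u < N)"

text \<open>
  A vertex of \<open>S\<close> with minimal value of \<open>L\<close> can have a predecessor in \<open>S\<close> only through a precedence of
  length 0.  Such a predecessor has the same minimal value, and, having an outgoing precedence, it is
  not itself entered by one of length 0.
\<close>
lemma exists_ready_vertex:
  assumes inst: "sound_instance N As Bs" and L: "schedule As Bs L"
    and S: "S \<subseteq> {..<N}" "S \<noteq> {}"
  obtains v where "v \<in> S" "\<And>u t. (u, v, t) \<in> set As \<Longrightarrow> u \<in> S \<Longrightarrow> u = v"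
proof -
  have "finite S" using S(1) finite_subset by blast
  with S(2) obtain v where v: "v \<in> S" "\<forall>u\<in>S. L v \<le> L u"
    using arg_min_if_finite(1) arg_min_least by metis
  have step: "L u + t \<le> L w" "0 < t \<or> t = 0 \<and> (\<forall>(u', v', t')\<in>set As. u' \<noteq> w)" if "(u, w, t) \<in> set As" for u w t
    using that inst L by (auto simp: sound_instance_def schedule_def sat_prec_def)
  show thesis
  proof (cases "\<exists>u t. (u, v, t) \<in> set As \<and> u \<in> S")
    case True
    then obtain u t where u: "(u, v, t) \<in> set As" "u \<in> S" by blast
    have "L u \<le> L v" using step[OF u(1)] by auto
    with v have min: "\<forall>w\<in>S. L u \<le> L w" by force
    have "w = u" if w: "(w, u, t') \<in> set As" "w \<in> S" for w t'
      using step[OF w(1)] u(1) min w(2) by force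
    with u(2) show ?thesis using that by blast
  next
    case False
    with v(1) show ?thesis using that by blast
  qed
qed

text \<open>
  Let \<open>v\<close> be a non-final vertex whose predecessors are final.  After the precedences have been
  handled, \<open>v\<close> is high enough for all its predecessors.  If it were outside all windows, lowering the
  least schedule at \<open>v\<close> to the current value would give a smaller schedule.  So either this value is
  already final or the sweep moves \<open>v\<close> past a window.
\<close>
lemma progress_sweep:
  assumes inst: "sound_instance N As Bs" and H: "schedule As Bs H"
    and nonneg: "\<forall>i. 0 \<le> fst p i" and le: "\<forall>i. fst p i \<le> least_schedule As Bs i"
    and S: "\<exists>v<N. fst p v \<noteq> least_schedule As Bs v"
  shows "progress N As Bs (fst p) < progress N As Bs (fst (sweep As Bs p))"
proof -
  let ?L = "least_schedule As Bs"
  note L = schedule_least_schedule[OF H]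
  define G where "G = fst p"
  define q where "q = fold relax_prec As (G, 1)"
  define G1 where "G1 = fst q"
  define G2 where "G2 = fst (fold relax_window Bs q)"
  have sweep: "fst (sweep As Bs p) = G2" by (simp add: sweep_def G2_def q_def G_def)
  have mono1: "G i \<le> G1 i" for i using fold_relax_prec_mono[of "(G, 1)"] by (simp add: G1_def q_def)
  have mono2: "G1 i \<le> G2 i" for i by (simp add: G1_def G2_def fold_relax_window_mono)
  have G1_le: "G1 i \<le> ?L i" for i
    unfolding G1_def q_def using L le by (intro fold_relax_prec_le) (auto simp: schedule_def G_def)
  have G2_le: "G2 i \<le> ?L i" for i
    using sweep_le[OF L le] by (simp add: sweep)
  let ?F = "\<lambda>G. {v. v < N \<and> G v = ?L v}"
  let ?J = "\<lambda>G. {i. i < length Bs \<and> snd (snd (Bs ! i)) \<le> G (fst (Bs ! i))}"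
  have F: "?F G \<subseteq> ?F G2" using mono1 mono2 G2_le by (auto intro!: antisym) (metis order_trans)
  have "G i \<le> G2 i" for i using mono1 mono2 by (rule order_trans)
  then have J: "?J G \<subseteq> ?J G2" using order_trans by blast
  obtain v where v: "v \<in> {v. v < N \<and> G v \<noteq> ?L v}"
    "\<And>u t. (u, v, t) \<in> set As \<Longrightarrow> u \<in> {v. v < N \<and> G v \<noteq> ?L v} \<Longrightarrow> u = v"
    using exists_ready_vertex[OF inst L, of "{v. v < N \<and> G v \<noteq> ?L v}"] S unfolding G_def by blast
  have "?F G \<subset> ?F G2 \<or> ?J G \<subset> ?J G2"
  proof (cases "G2 v = ?L v")
    case True
    then have "v \<in> ?F G2 - ?F G" using v(1) by simp
    with F show ?thesis by blast
  next
    case False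
    then have less: "G1 v < ?L v" using mono2[of v] G2_le[of v] by linarith
    \<comment> \<open>Otherwise \<open>v\<close> could be lowered to \<open>G1 v\<close>, and the least schedule would not be least.\<close>
    have "\<exists>lo hi. (v, lo, hi) \<in> set Bs \<and> lo < G1 v \<and> G1 v < hi"
    proof (rule ccontr)
      assume free: "\<not> ?thesis"
      have "0 \<le> G1 v" using nonneg mono1[of v] by (simp add: G_def) (metis order_trans)
      moreover have "sat_prec (?L(v := G1 v)) (a, b, t)" if ab: "(a, b, t) \<in> set As" for a b t
      proof -
        have Lab: "?L a + t \<le> ?L b" using L ab by (auto simp: schedule_def sat_prec_def)
        show ?thesis
        proof (cases "b = v \<and> a \<noteq> v")
          case True
          moreover have "a < N" using ab inst by (auto simp: sound_instance_def)
          ultimately have "G a = ?L a" using v(2)[of a t] ab by auto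
          then have "?L a + t \<le> G1 v"
            using fold_relax_prec_reaches[OF ab, of "(G, 1)"] True by (simp add: G1_def q_def)
          with True show ?thesis by (simp add: sat_prec_def)
        next
          case False
          with Lab less show ?thesis by (auto simp: sat_prec_def)
        qed
      qed
      moreover have "sat_window (?L(v := G1 v)) (a, lo, hi)" if "(a, lo, hi) \<in> set Bs" for a lo hi
        using that free L by (auto simp: schedule_def sat_window_def not_less)
      ultimately have "schedule As Bs (?L(v := G1 v))" using L by (auto simp: schedule_def)
      from least_schedule_le[OF this, of v] less show False by simp
    qed
    then obtain lo hi where b: "(v, lo, hi) \<in> set Bs" "lo < G1 v" "G1 v < hi" by blast
    then obtain i where i: "i < length Bs" "Bs ! i = (v, lo, hi)" by (auto simp: in_set_conv_nth)
    have "hi \<le> G2 v" using fold_relax_window_reaches[OF b(1), of q] b(2) by (simp add: G1_def G2_def)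
    then have "i \<in> ?J G2 - ?J G" using i b(3) mono1[of v] by auto
    with J show ?thesis by blast
  qed
  then have "card (?F G) < card (?F G2) \<or> card (?J G) < card (?J G2)"
    by (auto intro: psubset_card_mono)
  moreover have "card (?F G) \<le> card (?F G2)" "card (?J G) \<le> card (?J G2)"
    using F J by (auto intro: card_mono)
  ultimately show ?thesis unfolding progress_def sweep G_def[symmetric] by linarith
qed

lemma progress_le: "progress N As Bs G \<le> N + length Bs"
proof -
  have "card {v. v < N \<and> G v = least_schedule As Bs v} \<le> card {..<N}"
    "card {i. i < length Bs \<and> snd (snd (Bs ! i)) \<le> G (fst (Bs ! i))} \<le> card {..<length Bs}"
    by (rule card_mono; force)+
  then show ?thesis by (simp add: progress_def)
qed

text \<open>
  One sweep beyond the bound of the potential distinguishes the two cases: it changes nothing if all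
  coordinates are final, and it must change something if there is no schedule.
\<close>
theorem sweeps_solve:
  assumes inst: "sound_instance N As Bs" and r: "N + length Bs < r"
    and run: "(sweep As Bs ^^ r) (\<lambda>_. 0, 0) = (G, f)"
  shows "f = 1 \<and> schedule As Bs G \<and> (\<forall>H. schedule As Bs H \<longrightarrow> (\<forall>i. G i \<le> H i)) \<or>
    f = 0 \<and> (\<nexists>H. schedule As Bs H)"
proof -
  let ?p = "\<lambda>r. (sweep As Bs ^^ r) (\<lambda>_. 0, 0)"
  have nonneg: "0 \<le> fst (?p r) i" for r i
  proof (induction r)
    case (Suc r)
    then show ?case using sweep_mono[of "?p r" i As Bs] by simp
  qed simp
  have below: "fst (?p r) i \<le> H i" if "schedule As Bs H" for H r i
  proof (induction r arbitrary: i)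
    case 0
    then show ?case using that by (simp add: schedule_def)
  next
    case (Suc r)
    then show ?case using sweep_le[OF that] by simp
  qed
  obtain r' where r': "r = Suc r'" "N + length Bs \<le> r'" using r by (cases r) auto
  obtain G' f' where p': "?p r' = (G', f')" by fastforce
  with run r' have last: "sweep As Bs (G', f') = (G, f)" by simp
  show ?thesis
  proof (cases "\<exists>H. schedule As Bs H")
    case False
    then have "\<not> ((\<forall>x\<in>set As. sat_prec G' x) \<and> (\<forall>x\<in>set Bs. sat_window G' x))"
      using nonneg[of r'] p' by (auto simp: schedule_def)
    then show ?thesis using False sweep_flag[OF last] by (auto split: if_splits)
  next
    case True
    then obtain H where H: "schedule As Bs H" by blast
    let ?L = "least_schedule As Bs"
    note L = schedule_least_schedule[OF H]
    have final: "\<forall>v<N. fst (?p r) v = ?L v" if "N + length Bs \<le> r" for r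
    proof (rule ccontr)
      assume no: "\<not> ?thesis"
      have "i \<le> progress N As Bs (fst (?p i)) \<and> (i \<le> r \<longrightarrow> (\<exists>v<N. fst (?p i) v \<noteq> ?L v))" 
        if "i \<le> Suc r" for i
      proof -
        have ex: "\<exists>v<N. fst (?p i) v \<noteq> ?L v" if "i \<le> r" for i
        proof -
          obtain v where v: "v < N" "fst (?p r) v \<noteq> ?L v" using no by blast
          have "fst (?p i) v \<le> fst (?p r) v"
            using that by (rule lift_Suc_mono_le[of "\<lambda>r. fst (?p r) v", rotated]) (simp add: sweep_mono)
          then show ?thesis using v below[OF L, of r v] by (intro exI[of _ v]) auto
        qed
        have "i \<le> progress N As Bs (fst (?p i))" using \<open>i \<le> Suc r\<close>
        proof (induction i)
          case (Suc i)
          have "progress N As Bs (fst (?p i)) < progress N As Bs (fst (sweep As Bs (?p i)))"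
            using nonneg[of i] below[OF L, of i] ex[of i] Suc.prems by (intro progress_sweep[OF inst H]) auto
          then show ?case using Suc by simp
        qed simp
        with ex show ?thesis by blast
      qed
      from this[of "Suc r"] progress_le[of N As Bs "fst (?p (Suc r))"] that show False by simp
    qed
    have eq: "\<forall>v<N. G' v = ?L v" using final[OF r'(2)] p' by simp
    have "\<forall>x\<in>set As. sat_prec G' x" "\<forall>x\<in>set Bs. sat_window G' x"
      using L eq inst by (fastforce simp: schedule_def sound_instance_def sat_prec_def sat_window_def)+
    with sweep_flag[OF last] have "f = 1" "G = G'" "\<forall>x\<in>set As. sat_prec G x" "\<forall>x\<in>set Bs. sat_window G x"
      by auto
    moreover have "\<forall>i. 0 \<le> G i" using nonneg[of r] run by simp
    moreover have "\<forall>H. schedule As Bs H \<longrightarrow> (\<forall>i. G i \<le> H i)" using below[of _ r] run by simp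
    ultimately show ?thesis by (simp add: schedule_def)
  qed
qed

section \<open>The program\<close>

text \<open>
  Arrays of natural numbers: 0 holds the input; 1 and 2 the tails and heads of the precedences, 3 the
  vertices of the windows; 4 and 5 the lengths of these two lists.  The remaining ones are scalars: 6
  is the number of replicated vertices \<open>v_ikl\<close>; 7 the index of the first vertex of the current layer;
  8 and 9 are pointers into the input, to the next entry of the spatial solution and to the running-time
  of the current arc; 11 is the offset from the layer of the current arc's tail to that of its head;
  12, 13 and 14 are loop counters; 15 is the flag of the current sweep.

  Arrays of numbers: 0 holds the input and in the end the solution; 1 the lengths of the precedences;
  2 and 3 the bounds of the windows; 4 the current values of \<open>\<Gamma>\<close>.
\<close>
abbreviation scalar :: "nat \<Rightarrow> nexp" where "scalar a \<equiv> NM a (NC 0)"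
abbreviation put :: "nat \<Rightarrow> nexp \<Rightarrow> com" where "put a e \<equiv> NAssign a (NC 0) e"
abbreviation four :: "nexp \<Rightarrow> nexp" where "four e \<equiv> NPlus (NPlus e e) (NPlus e e)"
text \<open>
  The input describes arc \<open>i + 1\<close> by four consecutive entries from position \<open>3 + 4 * i\<close>.  During the
  loop over the arcs the counter 12 holds \<open>i\<close>.
\<close>
abbreviation arc_field :: "nat \<Rightarrow> nexp" where
  "arc_field j \<equiv> NM 0 (NPlus (NC (3 + j)) (four (scalar 12)))"

definition append_prec :: "nexp \<Rightarrow> nexp \<Rightarrow> rexp \<Rightarrow> com" where
  "append_prec u v t = Seq (NAssign 1 (scalar 4) u) (Seq (NAssign 2 (scalar 4) v)
     (Seq (RAssign 1 (scalar 4) t) (put 4 (NPlus (scalar 4) (NC 1)))))"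

definition append_window :: "nexp \<Rightarrow> rexp \<Rightarrow> rexp \<Rightarrow> com" where
  "append_window u lo hi = Seq (NAssign 3 (scalar 5) u) (Seq (RAssign 2 (scalar 5) lo)
     (Seq (RAssign 3 (scalar 5) hi) (put 5 (NPlus (scalar 5) (NC 1)))))"

definition chosen :: bexp where
  "chosen = BAnd (BNot (NLess (NM 0 (scalar 8)) (NC 1))) (BNot (NLess (NC 1) (NM 0 (scalar 8))))"

definition next_arc :: com where
  "next_arc = Seq (put 8 (NPlus (scalar 8) (NC 1))) (put 7 (NPlus (scalar 7) (NM 0 (NC 0))))"

text \<open>
  Pointer 8 starts behind the entries of the two virtual arcs that leave the source.  These are skipped:
  the source has value 0 in the least solution, so their constraints hold automatically.
\<close>
definition collect_ends :: com where
  "collect_ends = Seq (put 8 (NPlus (NC 5) (four (NM 0 (NC 1))))) (Seq (put 7 (NM 0 (NC 0)))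
     (For 12 (NM 0 (NC 2)) (Seq
        (Cond chosen (append_prec (scalar 7) (NPlus (scalar 6) (NC 1)) (RC 0)) Skip) next_arc)))"

definition arc_tail :: nexp where
  "arc_tail = NMinus (NPlus (scalar 7) (arc_field 0)) (NC 1)"

definition arc_head :: nexp where
  "arc_head = NMinus (NPlus (NPlus (scalar 7) (scalar 11)) (arc_field 1)) (NC 1)"

definition collect_windows :: com where
  "collect_windows = For 14 (arc_field 3)
     (append_window arc_tail
        (RMinus (RM 0 (NPlus (NPlus (scalar 9) (NC 1)) (NPlus (scalar 14) (scalar 14)))) (RM 0 (scalar 9)))
        (RM 0 (NPlus (NPlus (scalar 9) (NC 2)) (NPlus (scalar 14) (scalar 14)))))"

definition collect_layers :: com where
  "collect_layers = For 13 (NMinus (NPlus (NM 0 (NC 2)) (NC 1)) (arc_field 2))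
     (Seq (Cond chosen (Seq (append_prec arc_tail arc_head (RM 0 (scalar 9))) collect_windows) Skip)
        next_arc)"

definition collect_copies :: com where
  "collect_copies = For 12 (NM 0 (NC 1))
     (Seq (Seq (put 7 (NC 0)) (Cond (NLess (NC 0) (arc_field 2)) (put 11 (NM 0 (NC 0))) (put 11 (NC 0))))
       (Seq collect_layers
          (put 9 (NPlus (NPlus (scalar 9) (NC 1)) (NPlus (arc_field 3) (arc_field 3))))))"

definition collect :: com where
  "collect = Seq (For 12 (NPlus (NM 0 (NC 2)) (NC 1)) (put 6 (NPlus (scalar 6) (NM 0 (NC 0)))))
     (Seq collect_ends collect_copies)"

definition relax_prec_com :: com where
  "relax_prec_com = (let r = RPlus (RM 4 (NM 1 (scalar 12))) (RM 1 (scalar 12)) in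
     Cond (RLess (RM 4 (NM 2 (scalar 12))) r)
       (Seq (RAssign 4 (NM 2 (scalar 12)) r) (put 15 (NC 0))) Skip)"

definition relax_window_com :: com where
  "relax_window_com = (let r = RM 4 (NM 3 (scalar 12)) in
     Cond (BAnd (RLess (RM 2 (scalar 12)) r) (RLess r (RM 3 (scalar 12))))
       (Seq (RAssign 4 (NM 3 (scalar 12)) (RM 3 (scalar 12))) (put 15 (NC 0))) Skip)"

definition sweep_com :: com where
  "sweep_com = Seq (put 15 (NC 1))
     (Seq (For 12 (scalar 4) relax_prec_com) (For 12 (scalar 5) relax_window_com))"

text \<open>
  The number of vertices is array 6 plus 2, for source and destination; adding the number of windows and
  one more sweep gives the bound of \<open>sweeps_solve\<close>.
\<close>
definition sweeps :: com where
  "sweeps = For 13 (NPlus (NPlus (scalar 6) (scalar 5)) (NC 3)) sweep_com"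

definition write_answer :: com where
  "write_answer = Seq (For 12 (NPlus (scalar 6) (NC 2)) (RAssign 0 (scalar 12) (RM 4 (scalar 12))))
     (NAssign 0 (NC 0) (scalar 15))"

definition solve_tsp :: com where
  "solve_tsp = Seq collect (Seq sweeps write_answer)"

lemma mem_store [simp]:
  "nmem (nstore a i x s) b = (if b = a then (nmem s a)(i := x) else nmem s b)"
  "rmem (nstore a i x s) = rmem s"
  "rmem (rstore a i y s) b = (if b = a then (rmem s a)(i := y) else rmem s b)"
  "nmem (rstore a i y s) = nmem s"
  by (auto simp: nstore_def rstore_def)

text \<open>
  Loop bounds are expressions of size at most 50 throughout, which replaces the exact count of
  steps by a simpler one.
\<close>
lemma reach_For_le:
  assumes "I 0 (nstore i 0 0 s)"
    and "\<And>j s. I j s \<Longrightarrow> nmem s i 0 = j \<Longrightarrow> nval e s = N"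
    and "\<And>j s. j < N \<Longrightarrow> I j s \<Longrightarrow> nmem s i 0 = j \<Longrightarrow>
      reach c s T (\<lambda>s'. nmem s' i 0 = j \<and> I (Suc j) (nstore i 0 (Suc j) s'))"
    and "\<And>s. I N s \<Longrightarrow> nmem s i 0 = N \<Longrightarrow> Q s"
    and "N < q" "nsize e \<le> 50"
  shows "reach (For i e c) s (q * (T + 63)) Q"
proof (rule reach_mono[OF reach_For[OF assms(1-4)]])
  show "(N + 1) * (T + nsize e + 13) \<le> q * (T + 63)"
    by (rule mult_le_mono) (use assms(5,6) in auto)
qed

lemma reach_straight_le: "straight c \<Longrightarrow> Q (effect c s) \<Longrightarrow> csize c \<le> T \<Longrightarrow> reach c s T Q"
  by (rule reach_mono[OF reach_straight])

definition stores_precs :: "state \<Rightarrow> precedence list \<Rightarrow> bool" where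
  "stores_precs s As \<longleftrightarrow> nmem s 4 0 = length As \<and>
     (\<forall>i<length As. As ! i = (nmem s 1 i, nmem s 2 i, rmem s 1 i))"

definition stores_windows :: "state \<Rightarrow> window list \<Rightarrow> bool" where
  "stores_windows s Bs \<longleftrightarrow> nmem s 5 0 = length Bs \<and>
     (\<forall>i<length Bs. Bs ! i = (nmem s 3 i, rmem s 2 i, rmem s 3 i))"

definition sweeping :: "nat \<Rightarrow> precedence list \<Rightarrow> window list \<Rightarrow> (nat \<Rightarrow> real) \<times> nat \<Rightarrow> state \<Rightarrow> bool" where
  "sweeping N As Bs p s \<longleftrightarrow> stores_precs s As \<and> stores_windows s Bs \<and> nmem s 6 0 = N \<and>
     rmem s 4 = fst p \<and> nmem s 15 0 = snd p"

lemma sweeping_counter [simp]: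
  "a \<in> {12, 13} \<Longrightarrow> sweeping N As Bs p (nstore a i x s) = sweeping N As Bs p s"
  by (auto simp: sweeping_def stores_precs_def stores_windows_def)

lemma reach_relax_prec:
  assumes s: "sweeping N As Bs p s" and i: "nmem s 12 0 = i" "i < length As"
  shows "reach relax_prec_com s 60 (\<lambda>s'. nmem s' 12 0 = i \<and> nmem s' 13 = nmem s 13 \<and>
    sweeping N As Bs (relax_prec (As ! i) p) s')"
proof (rule reach_straight_le)
  obtain u v t where x: "As ! i = (u, v, t)" by (cases "As ! i")
  have m: "nmem s 1 i = u" "nmem s 2 i = v" "rmem s 1 i = t"
    using s i(2) x by (auto simp: sweeping_def stores_precs_def)
  obtain G f where p: "p = (G, f)" by (cases p)
  show "nmem (effect relax_prec_com s) 12 0 = i \<and> nmem (effect relax_prec_com s) 13 = nmem s 13 \<and>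
    sweeping N As Bs (relax_prec (As ! i) p) (effect relax_prec_com s)"
    using s i m by (simp add: relax_prec_com_def x p Let_def sweeping_def stores_precs_def stores_windows_def)
qed (simp_all add: relax_prec_com_def Let_def)

lemma reach_relax_window:
  assumes s: "sweeping N As Bs p s" and i: "nmem s 12 0 = i" "i < length Bs"
  shows "reach relax_window_com s 60 (\<lambda>s'. nmem s' 12 0 = i \<and> nmem s' 13 = nmem s 13 \<and>
    sweeping N As Bs (relax_window (Bs ! i) p) s')"
proof (rule reach_straight_le)
  obtain u lo hi where x: "Bs ! i = (u, lo, hi)" by (cases "Bs ! i")
  have m: "nmem s 3 i = u" "rmem s 2 i = lo" "rmem s 3 i = hi"
    using s i(2) x by (auto simp: sweeping_def stores_windows_def)
  obtain G f where p: "p = (G, f)" by (cases p)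
  show "nmem (effect relax_window_com s) 12 0 = i \<and> nmem (effect relax_window_com s) 13 = nmem s 13 \<and>
    sweeping N As Bs (relax_window (Bs ! i) p) (effect relax_window_com s)"
    using s i m by (simp add: relax_window_com_def x p Let_def sweeping_def stores_precs_def stores_windows_def)
qed (simp_all add: relax_window_com_def Let_def)

lemma reach_sweep:
  assumes s: "sweeping N As Bs p s" and q: "length As < q" "length Bs < q'"
  shows "reach sweep_com s (7 + (q * (60 + 63) + q' * (60 + 63))) (\<lambda>s'. nmem s' 13 = nmem s 13 \<and>
    sweeping N As Bs (sweep As Bs p) s')"
proof -
  let ?P = "\<lambda>p s'. nmem s' 13 = nmem s 13 \<and> sweeping N As Bs p s'"
  let ?r = "fold relax_prec As (fst p, 1)"
  have "reach (put 15 (NC 1)) s 7 (?P (fst p, 1))"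
    by (rule reach_straight_le) (use s in \<open>auto simp: sweeping_def stores_precs_def stores_windows_def\<close>)
  moreover have "reach (For 12 (scalar 4) relax_prec_com) s1 (q * (60 + 63)) (?P ?r)"
    if "?P (fst p, 1) s1" for s1
  proof (rule reach_For_le[where N = "length As" and
          I = "\<lambda>j. ?P (fold relax_prec (take j As) (fst p, 1))"])
    fix j s' assume j: "j < length As" "?P (fold relax_prec (take j As) (fst p, 1)) s'" "nmem s' 12 0 = j"
    show "reach relax_prec_com s' 60 (\<lambda>s''. nmem s'' 12 0 = j \<and>
        ?P (fold relax_prec (take (Suc j) As) (fst p, 1)) (nstore 12 0 (Suc j) s''))"
      using j by (intro reach_mono[OF reach_relax_prec[of N As Bs _ s' j]])
        (auto simp: take_Suc_conv_app_nth)
  qed (use q that in \<open>auto simp: sweeping_def stores_precs_def stores_windows_def\<close>)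
  moreover have "reach (For 12 (scalar 5) relax_window_com) s1 (q' * (60 + 63)) (?P (sweep As Bs p))"
    if "?P ?r s1" for s1
  proof (rule reach_For_le[where N = "length Bs" and
          I = "\<lambda>j. ?P (fold relax_window (take j Bs) ?r)"])
    fix j s' assume j: "j < length Bs" "?P (fold relax_window (take j Bs) ?r) s'" "nmem s' 12 0 = j"
    show "reach relax_window_com s' 60 (\<lambda>s''. nmem s'' 12 0 = j \<and>
        ?P (fold relax_window (take (Suc j) Bs) ?r) (nstore 12 0 (Suc j) s''))"
      using j by (intro reach_mono[OF reach_relax_window[of N As Bs _ s' j]])
        (auto simp: take_Suc_conv_app_nth)
  qed (use q that in \<open>auto simp: sweep_def sweeping_def stores_precs_def stores_windows_def\<close>)
  ultimately show ?thesis unfolding sweep_com_def by (blast intro: reach_Seq)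
qed

lemma reach_sweeps:
  assumes s: "sweeping N As Bs p s" and q: "length As < q" "length Bs < q'" "N + length Bs + 3 < q''"
  shows "reach sweeps s (q'' * (7 + (q * (60 + 63) + q' * (60 + 63)) + 63))
    (sweeping N As Bs ((sweep As Bs ^^ (N + length Bs + 3)) p))"
  unfolding sweeps_def
proof (rule reach_For_le[where N = "N + length Bs + 3" and
      I = "\<lambda>j. sweeping N As Bs ((sweep As Bs ^^ j) p)"])
  fix j s' assume "sweeping N As Bs ((sweep As Bs ^^ j) p) s'" "nmem s' 13 0 = j"
  then show "reach sweep_com s' (7 + (q * (60 + 63) + q' * (60 + 63))) (\<lambda>s''. nmem s'' 13 0 = j \<and>
      sweeping N As Bs ((sweep As Bs ^^ Suc j) p) (nstore 13 0 (Suc j) s''))"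
    using q by (intro reach_mono[OF reach_sweep[of N As Bs _ s' q q']]) auto
qed (use s q in \<open>auto simp: sweeping_def stores_precs_def stores_windows_def\<close>)

lemma reach_write_answer:
  assumes s: "sweeping N As Bs (G, f) s" and q: "N + 2 < q"
  shows "reach write_answer s (q * (60 + 63) + 60) (\<lambda>s'. nmem s' 0 0 = f \<and> (\<forall>i<N + 2. rmem s' 0 i = G i))"
  unfolding write_answer_def
proof (rule reach_Seq)
  let ?I = "\<lambda>j s'. nmem s' 6 0 = N \<and> nmem s' 15 0 = f \<and> rmem s' 4 = G \<and> (\<forall>i<j. rmem s' 0 i = G i)"
  show "reach (For 12 (NPlus (scalar 6) (NC 2)) (RAssign 0 (scalar 12) (RM 4 (scalar 12)))) s
     (q * (60 + 63)) (?I (N + 2))"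
    by (rule reach_For_le[where N = "N + 2" and I = ?I])
      (use s q in \<open>auto simp: sweeping_def less_Suc_eq intro!: reach_straight_le\<close>)
  show "reach (NAssign 0 (NC 0) (scalar 15)) s' 60 (\<lambda>s'. nmem s' 0 0 = f \<and> (\<forall>i<N + 2. rmem s' 0 i = G i))"
    if "?I (N + 2) s'" for s'
    by (rule reach_straight_le) (use that in auto)
qed

section \<open>Decoding the input\<close>

lemma upt_split: "a \<le> c \<Longrightarrow> c < b \<Longrightarrow> [a..<b] = [a..<c] @ c # [Suc c..<b]"
  by (metis le_add_diff_inverse less_imp_le upt_add_eq_append upt_conv_Cons)

lemma nth_concat_upt:
  assumes "a \<le> i" "i < b" "j < length (f i)"
  shows "length (concat (map f [a..<i])) + j < length (concat (map f [a..<b]))"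
    and "concat (map f [a..<b]) ! (length (concat (map f [a..<i])) + j) = f i ! j"
  using assms(3) by (simp_all add: upt_split[OF assms(1,2)] nth_append del: upt_Suc)

lemma length_pairs: "length (concat (map (\<lambda>(z, z'). [z, z']) xs)) = 2 * length xs"
  by (induction xs) auto

lemma nth_pairs:
  "j < length xs \<Longrightarrow> concat (map (\<lambda>(z, z'). [z, z']) xs) ! (2 * j) = fst (xs ! j)"
  "j < length xs \<Longrightarrow> concat (map (\<lambda>(z, z'). [z, z']) xs) ! Suc (2 * j) = snd (xs ! j)"
proof (induction xs arbitrary: j)
  case (Cons x xs)
  { case 1 then show ?case using Cons(1)[of "j - 1"] by (cases j) (auto split: prod.splits) }
  { case 2 then show ?case using Cons(2)[of "j - 1"] by (cases j) (auto split: prod.splits) }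
qed auto

lemma stores_precs_snoc:
  assumes "stores_precs s As" and "nmem s' 4 0 = Suc (length As)"
    "nmem s' 1 = (nmem s 1)(length As := u)" "nmem s' 2 = (nmem s 2)(length As := v)"
    "rmem s' 1 = (rmem s 1)(length As := t)"
  shows "stores_precs s' (As @ [(u, v, t)])"
  using assms by (auto simp: stores_precs_def nth_append less_Suc_eq)

lemma stores_windows_snoc:
  assumes "stores_windows s Bs" and "nmem s' 5 0 = Suc (length Bs)"
    "nmem s' 3 = (nmem s 3)(length Bs := u)" "rmem s' 2 = (rmem s 2)(length Bs := lo)"
    "rmem s' 3 = (rmem s 3)(length Bs := hi)"
  shows "stores_windows s' (Bs @ [(u, lo, hi)])"
  using assms by (auto simp: stores_windows_def nth_append less_Suc_eq)

lemma stores_cong: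
  "nmem s' 4 = nmem s 4 \<Longrightarrow> nmem s' 1 = nmem s 1 \<Longrightarrow> nmem s' 2 = nmem s 2 \<Longrightarrow> rmem s' 1 = rmem s 1 \<Longrightarrow>
    stores_precs s' As = stores_precs s As"
  "nmem s' 5 = nmem s 5 \<Longrightarrow> nmem s' 3 = nmem s 3 \<Longrightarrow> rmem s' 2 = rmem s 2 \<Longrightarrow> rmem s' 3 = rmem s 3 \<Longrightarrow>
    stores_windows s' Bs = stores_windows s Bs"
  by (simp_all add: stores_precs_def stores_windows_def)

lemma member_length_concat:
  "x \<in> set xs \<Longrightarrow> length (f x) \<le> length (concat (map f xs))"
  by (induction xs) auto

text \<open>
  The parameter \<open>X\<close> is the spatial solution of the current iteration.
\<close>
locale tsp_instance =
  fixes B :: base and X :: "rarc \<Rightarrow> nat" and k :: nat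
  assumes wf: "well_formed B"
begin

abbreviation "V \<equiv> num_verts B"
abbreviation "M \<equiv> num_arcs B"
abbreviation "R \<equiv> card (service B)"

definition nats :: "nat \<Rightarrow> nat" where "nats = nmem (load (tsp_input B X k)) 0"
definition reals :: "nat \<Rightarrow> real" where "reals = rmem (load (tsp_input B X k)) 0"

definition arc_copies :: "nat \<Rightarrow> rarc list" where
  "arc_copies m = map (Copy m k) [1..<last_layer B m + 1]"

text \<open>
  The arcs whose constraints are collected, in the order in which the input lists them.
\<close>
definition arc_list :: "rarc list" where
  "arc_list = map (End k) [2..<num_layers B + 1] @ concat (map arc_copies [1..<M + 1])"

text \<open>
  The arcs that precede the copy of arc \<open>i + 1\<close> in layer \<open>j + 1\<close>; the state of the two nested loops.
\<close>
definition before :: "nat \<Rightarrow> nat \<Rightarrow> rarc list" where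
  "before i j = map (End k) [2..<num_layers B + 1] @ concat (map arc_copies [1..<Suc i]) @
     map (Copy (Suc i) k) [1..<Suc j]"

lemma agent_arc_list_eq: "agent_arc_list B k = Start k # Direct k # arc_list"
  by (simp add: agent_arc_list_def arc_list_def arc_copies_def[abs_def])

lemma before_Suc: "before i (Suc j) = before i j @ [Copy (Suc i) k (Suc j)]"
  by (simp add: before_def)

lemma before_last: "before i (last_layer B (Suc i)) = before (Suc i) 0"
  by (simp add: before_def arc_copies_def[of "Suc i"])

lemma before_all: "before M 0 = arc_list"
  by (simp add: before_def arc_list_def)

lemma arc_list_split:
  assumes "i < M" "j < last_layer B (Suc i)"
  obtains rest where "arc_list = before i j @ Copy (Suc i) k (Suc j) # rest"
proof -
  have 1: "[1..<M + 1] = [1..<Suc i] @ Suc i # [Suc (Suc i)..<M + 1]"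
    by (rule upt_split) (use assms in auto)
  have 2: "[1..<last_layer B (Suc i) + 1] = [1..<Suc j] @ Suc j # [Suc (Suc j)..<last_layer B (Suc i) + 1]"
    by (rule upt_split) (use assms in auto)
  have "arc_copies (Suc i) = map (Copy (Suc i) k) [1..<Suc j] @ Copy (Suc i) k (Suc j) #
     map (Copy (Suc i) k) [Suc (Suc j)..<last_layer B (Suc i) + 1]"
    unfolding arc_copies_def 2 by simp
  then show thesis using that unfolding arc_list_def before_def 1 by simp
qed

lemma arc_list_split_ends:
  assumes "j < R"
  obtains rest where "arc_list = map (End k) [2..<j + 2] @ End k (j + 2) # rest"
proof -
  have "[2..<num_layers B + 1] = [2..<j + 2] @ (j + 2) # [Suc (j + 2)..<num_layers B + 1]"
    by (rule upt_split) (use assms in \<open>auto simp: num_layers_def\<close>)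
  then show thesis using that unfolding arc_list_def by simp
qed

definition arc_block :: "nat \<Rightarrow> nat list" where
  "arc_block m = [tail (base_graph B) m, head (base_graph B) m, of_bool (m \<in> service B), length (unav B m)]"

definition real_block :: "nat \<Rightarrow> real list" where
  "real_block m = rtime B m k # concat (map (\<lambda>(z, z'). [z, z']) (unav B m))"

lemma tsp_input_eq: "tsp_input B X k =
   ([V, M, R] @ concat (map arc_block [1..<M + 1]) @ map X (agent_arc_list B k),
    concat (map real_block [1..<M + 1]))"
  by (simp add: tsp_input_def arc_block_def[abs_def] real_block_def[abs_def])

lemma length_arc_blocks: "length (concat (map arc_block [1..<Suc i])) = 4 * i"
  by (induction i) (auto simp: arc_block_def)

lemma nats_eq: "i < length (fst (tsp_input B X k)) \<Longrightarrow> nats i = fst (tsp_input B X k) ! i"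
  by (simp add: nats_def load_def)

lemma nats_header: "nats 0 = V" "nats 1 = M" "nats (Suc 0) = M" "nats 2 = R"
  by (simp_all add: nats_eq tsp_input_eq)

lemma nats_arc:
  assumes "i < M" "j < 4"
  shows "nats (3 + j + 4 * i) = arc_block (Suc i) ! j"
proof -
  have "j < length (arc_block (Suc i))" using assms(2) by (simp add: arc_block_def)
  from nth_concat_upt[of 1 "Suc i" "M + 1" j arc_block, OF _ _ this] assms(1)
  have "4 * i + j < length (concat (map arc_block [1..<M + 1]))"
    "concat (map arc_block [1..<M + 1]) ! (4 * i + j) = arc_block (Suc i) ! j"
    unfolding length_arc_blocks by simp_all
  moreover have "3 + j + 4 * i = Suc (Suc (Suc (4 * i + j)))" by simp
  ultimately show ?thesis
    unfolding nats_def load_def tsp_input_eq by (simp add: nth_append add.commute del: upt_Suc)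
qed

lemma nats_chosen:
  assumes "i < length arc_list"
  shows "nats (5 + 4 * M + i) = X (arc_list ! i)"
proof -
  have "length (concat (map arc_block [1..<M + 1])) = 4 * M" using length_arc_blocks[of M] by simp
  moreover have "5 + 4 * M + i = Suc (Suc (Suc (4 * M + Suc (Suc i))))" by simp
  ultimately show ?thesis using assms
    by (simp add: nats_eq tsp_input_eq nth_append agent_arc_list_eq del: upt_Suc)
qed

text \<open>
  The position of the running-time of arc \<open>i + 1\<close>.
\<close>
definition real_ptr :: "nat \<Rightarrow> nat" where
  "real_ptr i = length (concat (map real_block [1..<Suc i]))"

lemma real_ptr_0: "real_ptr 0 = 0"
  by (simp add: real_ptr_def)

lemma real_ptr_Suc: "real_ptr (Suc i) = real_ptr i + 1 + 2 * length (unav B (Suc i))"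
  by (simp add: real_ptr_def real_block_def[of "Suc i"] length_pairs)

lemma reals_arc:
  assumes "i < M" "j < length (real_block (Suc i))"
  shows "reals (real_ptr i + j) = real_block (Suc i) ! j"
  using nth_concat_upt[of 1 "Suc i" "M + 1" j real_block] assms
  by (simp add: reals_def load_def tsp_input_eq real_ptr_def del: upt_Suc)

lemma reals_time: "i < M \<Longrightarrow> reals (real_ptr i) = rtime B (Suc i) k"
  using reals_arc[of i 0] by (simp add: real_block_def)

lemma reals_window:
  assumes "i < M" "j < length (unav B (Suc i))"
  shows "reals (Suc (real_ptr i + 2 * j)) = fst (unav B (Suc i) ! j)"
    and "reals (Suc (Suc (real_ptr i + 2 * j))) = snd (unav B (Suc i) ! j)"
  using reals_arc[of i "Suc (2 * j)"] reals_arc[of i "Suc (Suc (2 * j))"] assms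
  by (simp_all add: real_block_def length_pairs nth_pairs)

definition prec :: "rarc \<Rightarrow> precedence" where
  "prec a = (vertex_index B (rtail B a), vertex_index B (rhead B a), arc_time B a)"

text \<open>
  The unavailability from \<open>z\<close> to \<open>z'\<close> forbids departures that would overlap with it, that is, between
  \<open>z\<close> minus the running-time and \<open>z'\<close>.
\<close>
definition windows :: "rarc \<Rightarrow> window list" where
  "windows a = map (\<lambda>(z, z'). (vertex_index B (rtail B a), z - arc_time B a, z')) (arc_unav B a)"

definition precs :: "rarc list \<Rightarrow> precedence list" where
  "precs P = map prec (filter (\<lambda>a. X a = 1) P)"

definition all_windows :: "rarc list \<Rightarrow> window list" where
  "all_windows P = concat (map windows (filter (\<lambda>a. X a = 1) P))"

text \<open>
  The invariant of the decoding phase, with the constraint lists and the two input pointers as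
  parameters.
\<close>
definition collecting :: "precedence list \<Rightarrow> window list \<Rightarrow> nat \<Rightarrow> nat \<Rightarrow> state \<Rightarrow> bool" where
  "collecting As Bs xp rp s \<longleftrightarrow> nmem s 0 = nats \<and> rmem s 0 = reals \<and> nmem s 6 0 = num_layers B * V \<and>
     nmem s 8 0 = xp \<and> nmem s 9 0 = rp \<and> stores_precs s As \<and> stores_windows s Bs \<and>
     rmem s 4 = (\<lambda>_. 0) \<and> nmem s 15 0 = 0"

definition collected :: "rarc list \<Rightarrow> nat \<Rightarrow> state \<Rightarrow> bool" where
  "collected P = collecting (precs P) (all_windows P) (5 + 4 * M + length P)"

lemma collecting_frame [simp]:
  "a \<in> {7, 11, 12, 13, 14} \<Longrightarrow> collecting As Bs xp rp (nstore a i x s) = collecting As Bs xp rp s"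
  by (auto simp: collecting_def stores_precs_def stores_windows_def)

lemma collecting_chosen_ptr:
  "collecting As Bs xp rp s \<Longrightarrow> collecting As Bs xp' rp (nstore 8 0 xp' s)"
  by (auto simp: collecting_def stores_precs_def stores_windows_def)

lemma collecting_real_ptr:
  "collecting As Bs xp rp s \<Longrightarrow> collecting As Bs xp rp' (nstore 9 0 rp' s)"
  by (auto simp: collecting_def stores_precs_def stores_windows_def)

lemma collecting_append_prec:
  assumes s: "collecting As Bs xp rp s"
    and "nval u s = x" "nval v (nstore 1 (length As) x s) = y"
    and "rval t (nstore 2 (length As) y (nstore 1 (length As) x s)) = z"
  shows "collecting (As @ [(x, y, z)]) Bs xp rp (effect (append_prec u v t) s)"
proof -
  have n: "nmem s 4 0 = length As" using s by (simp add: collecting_def stores_precs_def)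
  have "stores_precs (effect (append_prec u v t) s) (As @ [(x, y, z)])"
    by (rule stores_precs_snoc[of s]) (use assms n in \<open>auto simp: append_prec_def collecting_def\<close>)
  moreover have "stores_windows (effect (append_prec u v t) s) Bs = stores_windows s Bs"
    by (rule stores_cong) (simp_all add: append_prec_def)
  ultimately show ?thesis using s by (simp add: collecting_def append_prec_def)
qed

lemma collecting_append_window:
  assumes s: "collecting As Bs xp rp s"
    and "nval u s = x" "rval lo (nstore 3 (length Bs) x s) = y"
    and "rval hi (rstore 2 (length Bs) y (nstore 3 (length Bs) x s)) = z"
  shows "collecting As (Bs @ [(x, y, z)]) xp rp (effect (append_window u lo hi) s)"
proof -
  have n: "nmem s 5 0 = length Bs" using s by (simp add: collecting_def stores_windows_def)
  have "stores_windows (effect (append_window u lo hi) s) (Bs @ [(x, y, z)])"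
    by (rule stores_windows_snoc[of s]) (use assms n in \<open>auto simp: append_window_def collecting_def\<close>)
  moreover have "stores_precs (effect (append_window u lo hi) s) As = stores_precs s As"
    by (rule stores_cong) (simp_all add: append_window_def)
  ultimately show ?thesis using s by (simp add: collecting_def append_window_def)
qed

lemma append_frame:
  "a \<notin> {1, 2, 4} \<Longrightarrow> nmem (effect (append_prec u v t) s) a = nmem s a"
  "a \<notin> {3, 5} \<Longrightarrow> nmem (effect (append_window w lo hi) s) a = nmem s a"
  by (simp_all add: append_prec_def append_window_def)

lemma bval_chosen:
  assumes "collected P rp s" "arc_list = P @ a # rest"
  shows "bval chosen s \<longleftrightarrow> X a = 1"
proof -
  have "nats (5 + 4 * M + length P) = X a" using nats_chosen[of "length P"] assms(2) by simp
  then show ?thesis using assms(1) by (auto simp: collected_def collecting_def chosen_def)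
qed

lemma effect_next_arc:
  assumes "collecting As Bs xp rp s" "nmem s 7 0 = b"
  shows "collecting As Bs (Suc xp) rp (effect next_arc s)" "nmem (effect next_arc s) 7 0 = b + V"
    "a \<notin> {7, 8} \<Longrightarrow> nmem (effect next_arc s) a = nmem s a"
proof -
  have eq: "effect next_arc s = nstore 7 0 (b + V) (nstore 8 0 (Suc xp) s)"
    using assms by (simp add: next_arc_def collecting_def nats_header)
  show "collecting As Bs (Suc xp) rp (effect next_arc s)"
    using collecting_chosen_ptr[OF assms(1)] by (simp add: eq)
  show "nmem (effect next_arc s) 7 0 = b + V" "a \<notin> {7, 8} \<Longrightarrow> nmem (effect next_arc s) a = nmem s a"
    by (simp_all add: eq)
qed

lemma straight_pieces:
  "rzero t \<Longrightarrow> straight (append_prec u v t)"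
  "rzero lo \<Longrightarrow> rzero hi \<Longrightarrow> straight (append_window u lo hi)"
  "straight next_arc" "bzero chosen" "bsize chosen = 15" "csize next_arc = 14"
  "csize (append_prec u v t) = 16 + nsize u + nsize v + rsize t"
  "csize (append_window u lo hi) = 16 + nsize u + rsize lo + rsize hi"
  by (simp_all add: append_prec_def append_window_def next_arc_def chosen_def)

lemma precs_snoc: "precs (P @ [a]) = precs P @ (if X a = 1 then [prec a] else [])"
  by (simp add: precs_def)

lemma all_windows_snoc: "all_windows (P @ [a]) = all_windows P @ (if X a = 1 then windows a else [])"
  by (simp add: all_windows_def)

lemma reach_collect_ends:
  assumes s: "collecting [] [] 0 0 s" and q: "R < q"
  shows "reach collect_ends s (60 + (60 + q * (90 + 63))) (collected (before 0 0) 0)"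
proof -
  let ?I = "\<lambda>j s'. collected (map (End k) [2..<j + 2]) 0 s' \<and> nmem s' 7 0 = Suc j * V"
  have "effect (put 8 (NPlus (NC 5) (four (NM 0 (NC 1))))) s = nstore 8 0 (5 + 4 * M) s"
    using s by (simp add: collecting_def nats_header add.commute)
  then have "reach (put 8 (NPlus (NC 5) (four (NM 0 (NC 1))))) s 60 (collecting [] [] (5 + 4 * M) 0)"
    using collecting_chosen_ptr[OF s] by (intro reach_straight_le) (simp_all del: effect.simps)
  moreover have "reach (put 7 (NM 0 (NC 0))) s1 60 (?I 0)" if s1: "collecting [] [] (5 + 4 * M) 0 s1" for s1
  proof (rule reach_straight_le)
    have "effect (put 7 (NM 0 (NC 0))) s1 = nstore 7 0 V s1"
      using s1 by (simp add: collecting_def nats_header)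
    then show "?I 0 (effect (put 7 (NM 0 (NC 0))) s1)"
      using s1 by (simp add: collected_def precs_def all_windows_def)
  qed simp_all
  moreover have "reach (For 12 (NM 0 (NC 2)) (Seq
      (Cond chosen (append_prec (scalar 7) (NPlus (scalar 6) (NC 1)) (RC 0)) Skip) next_arc)) s1
      (q * (90 + 63)) (collected (before 0 0) 0)" if "?I 0 s1" for s1
  proof (rule reach_For_le[where N = R and I = ?I])
    fix j s' assume j: "j < R" and I: "?I j s'" and n: "nmem s' 12 0 = j"
    let ?c = "append_prec (scalar 7) (NPlus (scalar 6) (NC 1)) (RC 0)"
    define P where "P = map (End k) [2..<j + 2]"
    define a where "a = End k (j + 2)"
    have P_Suc: "map (End k) [2..<Suc j + 2] = P @ [a]" by (simp add: P_def a_def)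
    define s2 where "s2 = (if X a = 1 then effect ?c s' else s')"
    obtain rest where split: "arc_list = P @ a # rest"
      using arc_list_split_ends[OF j] unfolding P_def a_def .
    have c: "collecting (precs P) (all_windows P) (5 + 4 * M + length P) 0 s'"
      using I by (simp add: collected_def P_def)
    have "collecting (precs P @ [(Suc j * V, num_layers B * V + 1, 0)]) (all_windows P)
        (5 + 4 * M + length P) 0 (effect ?c s')"
      by (rule collecting_append_prec[OF c]) (use I c in \<open>auto simp: collecting_def\<close>)
    moreover have "prec a = (Suc j * V, num_layers B * V + 1, 0)" "windows a = []"
      by (simp_all add: prec_def windows_def a_def)
    ultimately have c2: "collecting (precs (P @ [a])) (all_windows (P @ [a])) (5 + 4 * M + length P) 0 s2"
      using c by (simp add: s2_def precs_snoc all_windows_snoc)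
    have fr: "nmem s2 7 0 = Suc j * V" "nmem s2 12 0 = j"
      using I n by (auto simp: s2_def append_frame)
    have "collected (P @ [a]) 0 (effect next_arc s2)"
      using effect_next_arc(1)[OF c2 fr(1)] by (simp add: collected_def)
    then have post: "nmem (effect next_arc s2) 12 0 = j \<and> ?I (Suc j) (nstore 12 0 (Suc j) (effect next_arc s2))"
      unfolding P_Suc using effect_next_arc(2,3)[OF c2 fr(1)] fr(2) by (simp add: collected_def)
    have eq: "effect (Seq (Cond chosen ?c Skip) next_arc) s' = effect next_arc s2"
      using bval_chosen[of P 0 s' a rest] I split by (simp add: s2_def P_def)
    show "reach (Seq (Cond chosen ?c Skip) next_arc) s' 90
        (\<lambda>s'. nmem s' 12 0 = j \<and> ?I (Suc j) (nstore 12 0 (Suc j) s'))"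
      by (rule reach_straight_le, simp add: straight_pieces, unfold eq, rule post,
        simp add: straight_pieces)
  next
    fix s' assume "?I R s'"
    then show "collected (before 0 0) 0 s'"
      by (simp add: before_def num_layers_def del: upt_Suc)
  qed (use that q in \<open>auto simp: collected_def collecting_def nats_header
      stores_precs_def stores_windows_def\<close>)
  ultimately show ?thesis unfolding collect_ends_def by (blast intro: reach_Seq)
qed

lemma arc_fields:
  assumes "collecting As Bs xp rp s" "nmem s 12 0 = i" "i < M" "Suc i = m"
  shows "nval (arc_field 0) s = tail (base_graph B) m" "nval (arc_field 1) s = head (base_graph B) m"
    "nval (arc_field 2) s = of_bool (m \<in> service B)" "nval (arc_field 3) s = length (unav B m)"
  using assms nats_arc[of i 0] nats_arc[of i 1] nats_arc[of i 2] nats_arc[of i 3]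
  by (simp_all add: collecting_def arc_block_def numeral_eq_Suc algebra_simps)

lemma ends_in_verts:
  assumes "m \<in> arcs (base_graph B)"
  shows "tail (base_graph B) m \<in> {1..V}" "head (base_graph B) m \<in> {1..V}"
  using wf assms unfolding well_formed_def wf_digraph_def by metis+

lemma in_arcs_iff: "m \<in> arcs (base_graph B) \<longleftrightarrow> 1 \<le> m \<and> m \<le> M"
  using wf unfolding well_formed_def by (metis atLeastAtMost_iff)

lemma nval_arc_tail:
  assumes "collecting As Bs xp rp s" "nmem s 12 0 = i" "i < M" "nmem s 7 0 = j * V"
  shows "nval arc_tail s = vertex_index B (rtail B (Copy (Suc i) k (Suc j)))"
proof -
  have "Suc i \<in> arcs (base_graph B)" using assms(3) by (simp add: in_arcs_iff)
  then have "tail (base_graph B) (Suc i) \<in> {1..V}" by (rule ends_in_verts(1))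
  then show ?thesis using arc_fields(1)[OF assms(1-3) refl] assms(4) unfolding arc_tail_def by simp
qed

lemma nval_arc_head:
  assumes "collecting As Bs xp rp s" "nmem s 12 0 = i" "i < M" "nmem s 7 0 = j * V"
    "nmem s 11 0 = (if Suc i \<in> service B then V else 0)"
  shows "nval arc_head s = vertex_index B (rhead B (Copy (Suc i) k (Suc j)))"
proof -
  have "Suc i \<in> arcs (base_graph B)" using assms(3) by (simp add: in_arcs_iff)
  then have "head (base_graph B) (Suc i) \<in> {1..V}" by (rule ends_in_verts(2))
  then show ?thesis using arc_fields(2)[OF assms(1-3) refl] assms(4,5) unfolding arc_head_def by (simp add: ac_simps)
qed

lemma reach_collect_windows:
  assumes s: "collecting As Bs xp (real_ptr i) s" and i: "nmem s 12 0 = i" "i < M"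
    and j: "nmem s 7 0 = j * V" and q: "length (unav B (Suc i)) < q"
  shows "reach collect_windows s (q * (120 + 63)) (\<lambda>s'.
    collecting As (Bs @ windows (Copy (Suc i) k (Suc j))) xp (real_ptr i) s' \<and>
    (\<forall>a\<in>{7, 11, 12, 13}. nmem s' a = nmem s a))"
  unfolding collect_windows_def
proof (rule reach_For_le[where N = "length (unav B (Suc i))" and
      I = "\<lambda>n s'. collecting As (Bs @ take n (windows (Copy (Suc i) k (Suc j)))) xp (real_ptr i) s' \<and>
         (\<forall>a\<in>{7, 11, 12, 13}. nmem s' a = nmem s a)"])
  let ?I = "\<lambda>n s'. collecting As (Bs @ take n (windows (Copy (Suc i) k (Suc j)))) xp (real_ptr i) s' \<and>
         (\<forall>a\<in>{7, 11, 12, 13}. nmem s' a = nmem s a)"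
  let ?a = "Copy (Suc i) k (Suc j)"
  let ?lo = "RMinus (RM 0 (NPlus (NPlus (scalar 9) (NC 1)) (NPlus (scalar 14) (scalar 14)))) (RM 0 (scalar 9))"
  let ?hi = "RM 0 (NPlus (NPlus (scalar 9) (NC 2)) (NPlus (scalar 14) (scalar 14)))"
  fix n s' assume n: "n < length (unav B (Suc i))" and I: "?I n s'" and c: "nmem s' 14 0 = n"
  define Bs' where "Bs' = Bs @ take n (windows ?a)"
  have col: "collecting As Bs' xp (real_ptr i) s'" using I by (simp add: Bs'_def)
  then have mem: "nmem s' 9 0 = real_ptr i" "rmem s' 0 = reals" by (simp_all add: collecting_def)
  obtain z z' where z: "unav B (Suc i) ! n = (z, z')" by fastforce
  let ?x = "vertex_index B (rtail B ?a)"
  have "collecting As (Bs' @ [(?x, z - rtime B (Suc i) k, z')]) xp (real_ptr i)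
      (effect (append_window arc_tail ?lo ?hi) s')"
  proof (rule collecting_append_window[OF col])
    show "nval arc_tail s' = ?x"
      by (rule nval_arc_tail[OF col]) (use I i j in auto)
  qed (use reals_window[OF i(2) n] reals_time[OF i(2)] mem c z in \<open>simp_all add: mult_2\<close>)
  moreover have "Bs' @ [(?x, z - rtime B (Suc i) k, z')] = Bs @ take (Suc n) (windows ?a)"
    using n z by (simp add: Bs'_def take_Suc_conv_app_nth windows_def)
  ultimately have post: "nmem (effect (append_window arc_tail ?lo ?hi) s') 14 0 = n \<and>
      ?I (Suc n) (nstore 14 0 (Suc n) (effect (append_window arc_tail ?lo ?hi) s'))"
    using I c by (simp add: append_frame del: rtail.simps)
  show "reach (append_window arc_tail ?lo ?hi) s' 120
      (\<lambda>s''. nmem s'' 14 0 = n \<and> ?I (Suc n) (nstore 14 0 (Suc n) s''))"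
    by (rule reach_straight_le, simp add: straight_pieces, rule post,
      simp add: straight_pieces arc_tail_def)
next
  fix n s' assume I: "collecting As (Bs @ take n (windows (Copy (Suc i) k (Suc j)))) xp (real_ptr i) s' \<and>
    (\<forall>a\<in>{7, 11, 12, 13}. nmem s' a = nmem s a)"
  show "nval (arc_field 3) s' = length (unav B (Suc i))"
    by (rule arc_fields(4)[OF conjunct1[OF I]]) (use I i in auto)
qed (use s q in \<open>auto simp: windows_def\<close>)

definition layer_time :: "nat \<Rightarrow> nat" where
  "layer_time q = (15 + (120 + q * (120 + 63))) + 14"

lemma reach_collect_layers:
  assumes s: "collected (before i 0) (real_ptr i) s" and i: "nmem s 12 0 = i" "i < M"
    and "nmem s 7 0 = 0" and d: "nmem s 11 0 = (if Suc i \<in> service B then V else 0)"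
    and q: "length (unav B (Suc i)) < q" "last_layer B (Suc i) < q"
  shows "reach collect_layers s (q * (layer_time q + 63)) (\<lambda>s'.
    collected (before (Suc i) 0) (real_ptr i) s' \<and> nmem s' 12 0 = i)"
proof -
  let ?I = "\<lambda>j s'. collected (before i j) (real_ptr i) s' \<and> nmem s' 12 0 = i \<and> nmem s' 7 0 = j * V \<and>
    nmem s' 11 0 = nmem s 11 0"
  let ?c = "append_prec arc_tail arc_head (RM 0 (scalar 9))"
  show ?thesis
    unfolding collect_layers_def
  proof (rule reach_For_le[where N = "last_layer B (Suc i)" and I = ?I])
    fix j s' assume j: "j < last_layer B (Suc i)" and I: "?I j s'" and n: "nmem s' 13 0 = j"
    define P where "P = before i j"
    define a where "a = Copy (Suc i) k (Suc j)"
    obtain rest where split: "arc_list = P @ a # rest"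
      using arc_list_split[OF i(2) j] unfolding P_def a_def .
    have c: "collecting (precs P) (all_windows P) (5 + 4 * M + length P) (real_ptr i) s'"
      using I by (simp add: collected_def P_def)
    let ?J = "\<lambda>s''. collecting (precs (P @ [a])) (all_windows (P @ [a])) (5 + 4 * M + length P) (real_ptr i) s'' \<and>
       (\<forall>a\<in>{7, 11, 12, 13}. nmem s'' a = nmem s' a)"
    have "reach (Cond chosen (Seq ?c collect_windows) Skip) s' (15 + (120 + q * (120 + 63))) ?J"
    proof (rule reach_Cond[of chosen, unfolded straight_pieces])
      assume "bval chosen s'"
      then have X: "X a = 1" using bval_chosen[of P "real_ptr i" s' a rest] I split by (simp add: P_def)
      have "collecting (precs P @ [(vertex_index B (rtail B a), vertex_index B (rhead B a), arc_time B a)])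
          (all_windows P) (5 + 4 * M + length P) (real_ptr i) (effect ?c s')"
      proof (rule collecting_append_prec[OF c])
        show "nval arc_tail s' = vertex_index B (rtail B a)"
          unfolding a_def by (rule nval_arc_tail[OF c]) (use I i in auto)
        show "nval arc_head (nstore 1 (length (precs P)) x s') = vertex_index B (rhead B a)" for x
        proof -
          have "nval arc_head (nstore 1 (length (precs P)) x s') = nval arc_head s'"
            by (simp add: arc_head_def)
          also have "\<dots> = vertex_index B (rhead B a)"
            unfolding a_def by (rule nval_arc_head[OF c]) (use I i d in auto)
          finally show ?thesis .
        qed
      qed (use c reals_time[OF i(2)] in \<open>simp add: collecting_def a_def\<close>)
      then have 1: "collecting (precs (P @ [a])) (all_windows P) (5 + 4 * M + length P) (real_ptr i)
          (effect ?c s') \<and> (\<forall>a\<in>{7, 11, 12, 13}. nmem (effect ?c s') a = nmem s' a)"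
        using X by (simp add: precs_snoc prec_def append_frame)
      have "reach ?c s' 120 (\<lambda>s''. collecting (precs (P @ [a])) (all_windows P) (5 + 4 * M + length P)
          (real_ptr i) s'' \<and> (\<forall>a\<in>{7, 11, 12, 13}. nmem s'' a = nmem s' a))"
        by (rule reach_straight_le, simp add: straight_pieces, rule 1,
          simp add: straight_pieces arc_tail_def arc_head_def)
      then show "reach (Seq ?c collect_windows) s' (120 + q * (120 + 63)) ?J"
      proof (rule reach_Seq)
        fix s2 assume s2: "collecting (precs (P @ [a])) (all_windows P) (5 + 4 * M + length P)
          (real_ptr i) s2 \<and> (\<forall>a\<in>{7, 11, 12, 13}. nmem s2 a = nmem s' a)"
        have "reach collect_windows s2 (q * (120 + 63)) (\<lambda>s'.
            collecting (precs (P @ [a])) (all_windows P @ windows (Copy (Suc i) k (Suc j)))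
              (5 + 4 * M + length P) (real_ptr i) s' \<and>
            (\<forall>a\<in>{7, 11, 12, 13}. nmem s' a = nmem s2 a))"
          by (rule reach_collect_windows[OF conjunct1[OF s2]]) (use s2 I i q in auto)
        then show "reach collect_windows s2 (q * (120 + 63)) ?J"
          by (rule reach_mono) (use s2 X in \<open>auto simp: all_windows_snoc a_def\<close>)
      qed
    next
      assume "\<not> bval chosen s'"
      then have X: "X a \<noteq> 1" using bval_chosen[of P "real_ptr i" s' a rest] I split by (simp add: P_def)
      show "reach Skip s' (120 + q * (120 + 63)) ?J"
        by (rule reach_straight_le) (use X c in \<open>auto simp: precs_snoc all_windows_snoc\<close>)
    qed (simp add: straight_pieces)
    then show "reach (Seq (Cond chosen (Seq ?c collect_windows) Skip) next_arc) s' (layer_time q)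
        (\<lambda>s''. nmem s'' 13 0 = j \<and> ?I (Suc j) (nstore 13 0 (Suc j) s''))"
      unfolding layer_time_def
    proof (rule reach_Seq)
      fix s2 assume J: "?J s2"
      then have b: "nmem s2 7 0 = j * V" using I by simp
      note e = effect_next_arc[OF conjunct1[OF J] b]
      have post: "nmem (effect next_arc s2) 13 0 = j \<and> ?I (Suc j) (nstore 13 0 (Suc j) (effect next_arc s2))"
        using e J I n by (simp add: collected_def before_Suc P_def a_def)
      show "reach next_arc s2 14 (\<lambda>s''. nmem s'' 13 0 = j \<and> ?I (Suc j) (nstore 13 0 (Suc j) s''))"
        by (rule reach_straight_le, simp add: straight_pieces, rule post, simp add: straight_pieces)
    qed
  next
    fix j s' assume I: "?I j s'"
    then have c: "collecting (precs (before i j)) (all_windows (before i j)) (5 + 4 * M + length (before i j))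
        (real_ptr i) s'" and n: "nmem s' 12 0 = i" by (simp_all add: collected_def)
    have "nval (arc_field 2) s' = of_bool (Suc i \<in> service B)"
      by (rule arc_fields(3)[OF c n i(2) refl])
    moreover have "nmem s' 0 = nats" using I by (simp add: collected_def collecting_def)
    ultimately show "nval (NMinus (NPlus (NM 0 (NC 2)) (NC 1)) (arc_field 2)) s' = last_layer B (Suc i)"
      by (simp add: nats_header last_layer_def num_layers_def)
  next
    fix s' assume "?I (last_layer B (Suc i)) s'"
    then show "collected (before (Suc i) 0) (real_ptr i) s' \<and> nmem s' 12 0 = i"
      by (simp add: before_last)
  qed (use s i assms(4) q in \<open>auto simp: collected_def\<close>)
qed

lemma reach_collect_copies:
  assumes s: "collected (before 0 0) 0 s"
    and q: "M < q" "num_layers B < q" "\<And>m. m \<in> {1..M} \<Longrightarrow> length (unav B m) < q"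
  shows "reach collect_copies s (q * ((80 + (q * (layer_time q + 63) + 80)) + 63))
    (\<lambda>s'. \<exists>rp. collected arc_list rp s')"
  unfolding collect_copies_def
proof (rule reach_For_le[where N = M and I = "\<lambda>i. collected (before i 0) (real_ptr i)"])
  let ?pre = "Seq (put 7 (NC 0)) (Cond (NLess (NC 0) (arc_field 2)) (put 11 (NM 0 (NC 0))) (put 11 (NC 0)))"
  let ?post = "put 9 (NPlus (NPlus (scalar 9) (NC 1)) (NPlus (arc_field 3) (arc_field 3)))"
  fix i s1 assume i: "i < M" and I: "collected (before i 0) (real_ptr i) s1" and n: "nmem s1 12 0 = i"
  let ?d = "if Suc i \<in> service B then V else 0"
  have c: "collecting (precs (before i 0)) (all_windows (before i 0)) (5 + 4 * M + length (before i 0)) (real_ptr i) s1"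
    using I by (simp add: collected_def)
  have "collecting (precs (before i 0)) (all_windows (before i 0)) (5 + 4 * M + length (before i 0)) (real_ptr i) (nstore 7 0 0 s1)"
    using c by simp
  note f = arc_fields(3)[OF this _ i refl]
  have m: "nmem s1 0 = nats" using c by (simp add: collecting_def)
  have eq: "effect ?pre s1 = nstore 11 0 ?d (nstore 7 0 0 s1)"
    using f n m by (simp add: nats_header)
  have pre: "reach ?pre s1 80 (\<lambda>s'. s' = nstore 11 0 ?d (nstore 7 0 0 s1))"
    by (rule reach_straight_le, simp, rule eq, simp)
  have layers: "reach collect_layers (nstore 11 0 ?d (nstore 7 0 0 s1)) (q * (layer_time q + 63)) (\<lambda>s'.
      collected (before (Suc i) 0) (real_ptr i) s' \<and> nmem s' 12 0 = i)"
  proof (rule reach_collect_layers)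
    show "last_layer B (Suc i) < q" using q(2) by (auto simp: last_layer_def)
  qed (use I n i q(3) in \<open>auto simp: collected_def\<close>)
  have post: "reach ?post s' 80 (\<lambda>s''. nmem s'' 12 0 = i \<and>
      collected (before (Suc i) 0) (real_ptr (Suc i)) (nstore 12 0 (Suc i) s''))"
    if s': "collected (before (Suc i) 0) (real_ptr i) s' \<and> nmem s' 12 0 = i" for s'
  proof (rule reach_straight_le)
    have c: "collecting (precs (before (Suc i) 0)) (all_windows (before (Suc i) 0))
        (5 + 4 * M + length (before (Suc i) 0)) (real_ptr i) s'"
      using s' by (simp add: collected_def)
    have "nval (arc_field 3) s' = length (unav B (Suc i))"
      by (rule arc_fields(4)[OF c _ i refl]) (use s' in simp)
    moreover have "nval (scalar 9) s' = real_ptr i" "nval (NC 1) s' = 1" "nval (NC 0) s' = 0"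
      using c by (simp_all add: collecting_def)
    moreover have "real_ptr (Suc i) = real_ptr i + 1 + (length (unav B (Suc i)) + length (unav B (Suc i)))"
      by (simp add: real_ptr_Suc)
    ultimately have "effect ?post s' = nstore 9 0 (real_ptr (Suc i)) s'"
      by (simp only: effect.simps nval.simps(3))
    moreover have "collected (before (Suc i) 0) (real_ptr (Suc i)) (nstore 9 0 (real_ptr (Suc i)) s')"
      using collecting_real_ptr[OF c] by (simp add: collected_def)
    ultimately show "nmem (effect ?post s') 12 0 = i \<and>
        collected (before (Suc i) 0) (real_ptr (Suc i)) (nstore 12 0 (Suc i) (effect ?post s'))"
      using s' by (simp add: collected_def del: effect.simps)
  qed simp_all
  show "reach (Seq ?pre (Seq collect_layers ?post)) s1 (80 + (q * (layer_time q + 63) + 80))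
     (\<lambda>s'. nmem s' 12 0 = i \<and> collected (before (Suc i) 0) (real_ptr (Suc i)) (nstore 12 0 (Suc i) s'))"
  proof (rule reach_Seq[OF pre])
    fix s' assume s': "s' = nstore 11 0 ?d (nstore 7 0 0 s1)"
    show "reach (Seq collect_layers ?post) s' (q * (layer_time q + 63) + 80) (\<lambda>s'. nmem s' 12 0 = i \<and>
      collected (before (Suc i) 0) (real_ptr (Suc i)) (nstore 12 0 (Suc i) s'))"
      unfolding s' by (rule reach_Seq[OF layers]) (rule post)
  qed
next
  fix s' assume "collected (before M 0) (real_ptr M) s'"
  then show "\<exists>rp. collected arc_list rp s'" by (auto simp: before_all)
next
  show "collected (before 0 0) (real_ptr 0) (nstore 12 0 0 s)"
    using s by (simp add: collected_def real_ptr_0)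
next
  fix j s' assume "collected (before j 0) (real_ptr j) s'"
  then show "nval (NM 0 (NC 1)) s' = M" by (simp add: collected_def collecting_def nats_header)
qed (use q in auto)

lemma reach_collect:
  assumes q: "M < q" "num_layers B < q" "\<And>m. m \<in> {1..M} \<Longrightarrow> length (unav B m) < q"
  shows "reach collect (load (tsp_input B X k))
    (q * (60 + 63) + ((60 + (60 + q * (90 + 63))) + q * ((80 + (q * (layer_time q + 63) + 80)) + 63)))
    (\<lambda>s'. \<exists>rp. collected arc_list rp s')"
proof -
  let ?s = "load (tsp_input B X k)"
  let ?I = "\<lambda>j (s' :: state). nmem s' 6 0 = j * V \<and> nmem s' 0 = nats \<and> rmem s' 0 = reals \<and> rmem s' 4 = (\<lambda>_. 0) \<and>
    nmem s' 4 0 = 0 \<and> nmem s' 5 0 = 0 \<and> nmem s' 8 0 = 0 \<and> nmem s' 9 0 = 0 \<and> nmem s' 15 0 = 0"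
  have "reach (For 12 (NPlus (NM 0 (NC 2)) (NC 1)) (put 6 (NPlus (scalar 6) (NM 0 (NC 0))))) ?s (q * (60 + 63))
     (collecting [] [] 0 0)"
  proof (rule reach_For_le[where N = "num_layers B" and I = ?I])
    show "?I 0 (nstore 12 0 0 ?s)"
      by (simp add: nats_def reals_def) (simp add: load_def)
    fix j s' assume "?I j s'" "nmem s' 12 0 = j"
    then show "reach (put 6 (NPlus (scalar 6) (NM 0 (NC 0)))) s' 60
       (\<lambda>s'. nmem s' 12 0 = j \<and> ?I (Suc j) (nstore 12 0 (Suc j) s'))"
      by (intro reach_straight_le) (simp_all add: nats_header)
  qed (use q in \<open>auto simp: nats_header num_layers_def collecting_def stores_precs_def stores_windows_def\<close>)
  then show ?thesis
    unfolding collect_def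
  proof (rule reach_Seq)
    fix s' assume s': "collecting [] [] 0 0 s'"
    have R: "R < q" using q(2) by (simp add: num_layers_def)
    show "reach (Seq collect_ends collect_copies) s'
        ((60 + (60 + q * (90 + 63))) + q * ((80 + (q * (layer_time q + 63) + 80)) + 63))
        (\<lambda>s'. \<exists>rp. collected arc_list rp s')"
      by (rule reach_Seq[OF reach_collect_ends[OF s' R]], rule reach_collect_copies, assumption) (use q in auto)
  qed
qed

section \<open>Constraint lists and the temporal sub-problem\<close>

lemma in_verts_iff: "v \<in> verts (base_graph B) \<longleftrightarrow> 1 \<le> v \<and> v \<le> V"
  using wf unfolding well_formed_def by (metis atLeastAtMost_iff)

lemma one_vertex: "1 \<le> V"
  using wf in_verts_iff unfolding well_formed_def by (metis order_trans)

lemma arc_list_iff: "a \<in> set arc_list \<longleftrightarrow> a \<in> agent_arcs B k \<and> a \<noteq> Start k \<and> a \<noteq> Direct k"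
proof -
  have "Start k \<notin> set arc_list" "Direct k \<notin> set arc_list"
    by (auto simp: arc_list_def arc_copies_def)
  then show ?thesis using set_agent_arc_list[OF wf, of k] by (auto simp: agent_arc_list_eq)
qed

lemma agent_arc_ends:
  assumes "a \<in> agent_arcs B k"
  shows "rtail B a \<in> agent_verts B k" "rhead B a \<in> agent_verts B k"
proof -
  have d: "1 \<in> verts (base_graph B)" using in_verts_iff one_vertex by simp
  have e: "m \<in> arcs (base_graph B) \<Longrightarrow>
      tail (base_graph B) m \<in> verts (base_graph B) \<and> head (base_graph B) m \<in> verts (base_graph B)" for m
    using wf unfolding well_formed_def wf_digraph_def by blast
  show "rtail B a \<in> agent_verts B k" "rhead B a \<in> agent_verts B k"
    using assms d e by (auto simp: agent_arcs_def agent_verts_def last_layer_def num_layers_def split: if_splits)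
qed

lemma vertex_index_Vert:
  assumes "Vert i k l \<in> agent_verts B k"
  shows "vertex_index B (Vert i k l) < num_layers B * V"
proof -
  have "1 \<le> i" "i \<le> V" "1 \<le> l" "l \<le> num_layers B"
    using assms in_verts_iff by (auto simp: agent_verts_def)
  then have "i - 1 < V" "l - 1 \<le> num_layers B - 1" "1 \<le> num_layers B" by auto
  then have "(l - 1) * V + (i - 1) < (num_layers B - 1) * V + V"
    by (intro add_le_less_mono mult_le_mono) auto
  also have "\<dots> = num_layers B * V" using \<open>1 \<le> num_layers B\<close> by (simp add: mult_eq_if)
  finally show ?thesis by simp
qed

lemma vertex_index_less: "v \<in> agent_verts B k \<Longrightarrow> vertex_index B v < num_layers B * V + 2"
  using vertex_index_Vert by (force simp: agent_verts_def)

lemma inj_vertex_index: "inj_on (vertex_index B) (agent_verts B k)"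
proof (rule inj_onI)
  fix v w assume v: "v \<in> agent_verts B k" and w: "w \<in> agent_verts B k"
    and eq: "vertex_index B v = vertex_index B w"
  have Vert: "i = i' \<and> l = l'" if "Vert i k l \<in> agent_verts B k" "Vert i' k l' \<in> agent_verts B k"
    "vertex_index B (Vert i k l) = vertex_index B (Vert i' k l')" for i l i' l'
  proof -
    have b: "1 \<le> i" "i \<le> V" "1 \<le> l" "1 \<le> i'" "i' \<le> V" "1 \<le> l'"
      using that(1,2) in_verts_iff by (auto simp: agent_verts_def)
    then have "i - 1 < V" "i' - 1 < V" by auto
    moreover have "(l - 1) * V + (i - 1) = (l' - 1) * V + (i' - 1)" using that(3) by simp
    ultimately have "l - 1 = l' - 1" "i - 1 = i' - 1"
      by (metis div_mult_self3 div_less add.right_neutral less_nat_zero_code,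
          metis mod_mult_self3 mod_less)
    with b show ?thesis by auto
  qed
  have kinds: "(\<exists>i l. u = Vert i k l \<and> vertex_index B u < num_layers B * V) \<or> u = Src k \<or> u = Dst k"
    if "u \<in> agent_verts B k" for u
    using that vertex_index_Vert[of _ _] by (auto simp: agent_verts_def simp del: vertex_index.simps)
  show "v = w"
  proof (cases "vertex_index B v < num_layers B * V")
    case True
    with kinds[OF v] kinds[OF w] eq obtain i l i' l' where "v = Vert i k l" "w = Vert i' k l'" by auto
    with Vert v w eq show ?thesis by blast
  next
    case False
    with kinds[OF v] kinds[OF w] eq have "v \<in> {Src k, Dst k}" "w \<in> {Src k, Dst k}" by auto
    with eq show ?thesis by auto
  qed
qed

text \<open>
  In terms of the arcs, the two constraint lists are the constraints of the sub-problem except those of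
  the two arcs that leave the source.
\<close>
lemma schedule_iff:
  "schedule (precs arc_list) (all_windows arc_list) G \<longleftrightarrow> (\<forall>i. 0 \<le> G i) \<and>
     (\<forall>a\<in>set arc_list. X a = 1 \<longrightarrow>
        G (vertex_index B (rtail B a)) + arc_time B a \<le> G (vertex_index B (rhead B a)) \<and>
        (\<forall>(z, z')\<in>set (arc_unav B a). G (vertex_index B (rtail B a)) \<le> z - arc_time B a \<or>
           z' \<le> G (vertex_index B (rtail B a))))"
  unfolding schedule_def precs_def all_windows_def
  by (fastforce simp: sat_prec_def sat_window_def prec_def windows_def)

lemma sound_instance_arc_list:
  assumes k: "k \<in> agents B"
  shows "sound_instance (num_layers B * V + 2) (precs arc_list) (all_windows arc_list)"
proof -
  have ends: "vertex_index B (rtail B a) < num_layers B * V" (is ?t)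
    "vertex_index B (rhead B a) < num_layers B * V \<and> 0 < arc_time B a \<or>
     vertex_index B (rhead B a) = num_layers B * V + 1 \<and> arc_time B a = 0" (is ?h)
    if "a \<in> set arc_list" for a
  proof -
    have a: "a \<in> agent_arcs B k" "a \<noteq> Start k" "a \<noteq> Direct k" using that arc_list_iff by auto
    note e = agent_arc_ends[OF a(1)]
    from a consider (copy) m l where "a = Copy m k l" "m \<in> arcs (base_graph B)" | (fin) l where "a = End k l"
      by (auto simp: agent_arcs_def)
    then have "?t \<and> ?h"
    proof cases
      case copy
      then have "0 < rtime B m k" using wf k by (auto simp: well_formed_def)
      then show ?thesis using e vertex_index_Vert unfolding copy(1) by (auto simp del: vertex_index.simps)
    next
      case fin
      then show ?thesis using e vertex_index_Vert by (auto simp del: vertex_index.simps(1))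
    qed
    then show ?t ?h by auto
  qed
  have p: "u < num_layers B * V \<and> (v < num_layers B * V \<and> 0 < t \<or> v = num_layers B * V + 1 \<and> t = 0)"
    if "(u, v, t) \<in> set (precs arc_list)" for u v t
    using that ends by (auto simp: precs_def prec_def)
  have w: "u < num_layers B * V" if "(u, lo, hi) \<in> set (all_windows arc_list)" for u lo hi
    using that ends by (auto simp: all_windows_def windows_def)
  show ?thesis
    unfolding sound_instance_def
  proof (intro conjI ballI)
    fix x assume x: "x \<in> set (precs arc_list)"
    obtain u v t where uvt: "x = (u, v, t)" by (cases x)
    have "u' \<noteq> num_layers B * V + 1" if "(u', v', t') \<in> set (precs arc_list)" for u' v' t'
      using p[OF that] by simp
    then show "case x of (u, v, t) \<Rightarrow> u < num_layers B * V + 2 \<and> v < num_layers B * V + 2 \<and>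
        (0 < t \<or> t = 0 \<and> (\<forall>(u', v', t')\<in>set (precs arc_list). u' \<noteq> v))"
      using p[of u v t] x unfolding uvt by auto
  next
    fix x assume x: "x \<in> set (all_windows arc_list)"
    obtain u lo hi where uw: "x = (u, lo, hi)" by (cases x)
    show "case x of (u, lo, hi) \<Rightarrow> u < num_layers B * V + 2"
      using w[of u lo hi] x unfolding uw by simp
  qed
qed

text \<open>
  Indices that belong to no vertex get the value 0.
\<close>
lemma schedule_of_feasible:
  assumes "tsp_feasible B X k \<Gamma>"
  obtains G where "schedule (precs arc_list) (all_windows arc_list) G"
    "\<And>v. v \<in> agent_verts B k \<Longrightarrow> G (vertex_index B v) = \<Gamma> v"
proof
  let ?G = "\<lambda>i. if i \<in> vertex_index B ` agent_verts B k
    then \<Gamma> (inv_into (agent_verts B k) (vertex_index B) i) else 0"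
  show G: "?G (vertex_index B v) = \<Gamma> v" if "v \<in> agent_verts B k" for v
    using that inj_vertex_index by simp
  have "0 \<le> ?G i" for i using assms G by (auto simp: tsp_feasible_def)
  moreover have "?G (vertex_index B (rtail B a)) + arc_time B a \<le> ?G (vertex_index B (rhead B a)) \<and>
        (\<forall>(z, z')\<in>set (arc_unav B a). ?G (vertex_index B (rtail B a)) \<le> z - arc_time B a \<or>
           z' \<le> ?G (vertex_index B (rtail B a)))" if "a \<in> set arc_list" "X a = 1" for a
  proof -
    have a: "a \<in> agent_arcs B k" using that arc_list_iff by auto
    show ?thesis
      using assms that(2) a unfolding G[OF agent_arc_ends(1)[OF a]] G[OF agent_arc_ends(2)[OF a]] tsp_feasible_def
      by (auto simp: add.commute)
  qed
  ultimately show "schedule (precs arc_list) (all_windows arc_list) ?G"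
    unfolding schedule_iff by blast
qed

text \<open>
  The arcs leaving the source are missing from the constraint lists.  Their constraints follow from
  minimality: no listed constraint mentions the source, so its value could be lowered to 0.
\<close>
lemma optimal_of_least_schedule:
  assumes k: "k \<in> agents B"
    and G: "schedule (precs arc_list) (all_windows arc_list) G"
    and least: "\<And>H i. schedule (precs arc_list) (all_windows arc_list) H \<Longrightarrow> G i \<le> H i"
    and g: "\<And>i. i < num_layers B * V + 2 \<Longrightarrow> g i = G i"
  shows "tsp_optimal B X k (\<lambda>v. g (vertex_index B v))"
proof -
  let ?s = "num_layers B * V"
  have gG: "v \<in> agent_verts B k \<Longrightarrow> g (vertex_index B v) = G (vertex_index B v)" for v
    using vertex_index_less g by simp
  have in_verts: "Src k \<in> agent_verts B k" "Dst k \<in> agent_verts B k" by (auto simp: agent_verts_def)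
  have "schedule (precs arc_list) (all_windows arc_list) (G(?s := 0))"
  proof -
    have "vertex_index B (rtail B a) \<noteq> ?s" "vertex_index B (rhead B a) \<noteq> ?s" if "a \<in> set arc_list" for a
    proof -
      have a: "a \<in> agent_arcs B k" "a \<noteq> Start k" "a \<noteq> Direct k" using that arc_list_iff by auto
      note ends = agent_arc_ends[OF a(1)]
      have "rtail B a \<noteq> Src k" "rhead B a \<noteq> Src k" using a by (auto simp: agent_arcs_def)
      then have "vertex_index B (rtail B a) \<noteq> vertex_index B (Src k)"
        "vertex_index B (rhead B a) \<noteq> vertex_index B (Src k)"
        using ends in_verts(1) inj_vertex_index by (metis inj_on_contraD)+
      then show "vertex_index B (rtail B a) \<noteq> ?s" "vertex_index B (rhead B a) \<noteq> ?s" by simp_all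
    qed
    with G show ?thesis unfolding schedule_iff by auto
  qed
  from least[OF this, of ?s] have "G ?s \<le> 0" by simp
  then have src: "g (vertex_index B (Src k)) \<le> 0" using g[of ?s] by simp
  have nonneg: "0 \<le> g (vertex_index B v)" if "v \<in> agent_verts B k" for v
    using gG[OF that] G by (simp add: schedule_iff)
  have "g (vertex_index B (rhead B a)) \<ge> arc_time B a + g (vertex_index B (rtail B a)) \<and>
    (\<forall>(z, z') \<in> set (arc_unav B a). g (vertex_index B (rtail B a)) \<le> z - arc_time B a \<or>
      g (vertex_index B (rtail B a)) \<ge> z')" if a: "a \<in> agent_arcs B k" "X a = 1" for a
  proof (cases "a = Start k \<or> a = Direct k")
    case True
    then have "rtail B a = Src k" "arc_time B a = 0" "arc_unav B a = []" by auto
    then show ?thesis using nonneg[OF agent_arc_ends(2)[OF a(1)]] src by simp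
  next
    case False
    then have "a \<in> set arc_list" using a(1) arc_list_iff by simp
    then show ?thesis
      using G a(2) unfolding schedule_iff gG[OF agent_arc_ends(1)[OF a(1)]] gG[OF agent_arc_ends(2)[OF a(1)]]
      by (auto simp: add.commute)
  qed
  with nonneg have "tsp_feasible B X k (\<lambda>v. g (vertex_index B v))"
    unfolding tsp_feasible_def by blast
  moreover have "g (vertex_index B (Dst k)) \<le> \<Gamma> (Dst k)" if feas: "tsp_feasible B X k \<Gamma>" for \<Gamma>
  proof -
    obtain H where H: "schedule (precs arc_list) (all_windows arc_list) H"
      "\<And>v. v \<in> agent_verts B k \<Longrightarrow> H (vertex_index B v) = \<Gamma> v"
      using schedule_of_feasible[OF feas] by blast
    show ?thesis using least[OF H(1)] H(2) gG in_verts(2) by metis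
  qed
  ultimately show ?thesis by (simp add: tsp_optimal_def)
qed

lemma finite_arcs: "finite (arcs (base_graph B))"
  using wf unfolding well_formed_def by (metis finite_atLeastAtMost)

text \<open>
  If there are at least two vertices, each of them is the tail of an arc.
\<close>
lemma verts_le_arcs:
  assumes "well_defined B"
  shows "V \<le> M + 1"
proof (cases "V \<le> 1")
  case False
  let ?H = "(base_graph B)\<lparr>arcs := arcs (base_graph B) - service B\<rparr>"
  have sc: "strongly_connected ?H" using assms by (simp add: well_defined_def)
  have "v \<in> tail (base_graph B) ` arcs (base_graph B)" if v: "v \<in> verts (base_graph B)" for v
  proof -
    define w :: nat where "w = (if v = 1 then 2 else 1)"
    have w: "w \<in> verts (base_graph B)" "w \<noteq> v" using False in_verts_iff by (auto simp: w_def)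
    have "v \<rightarrow>\<^sup>*\<^bsub>?H\<^esub> w" using sc v w(1) by (auto simp: strongly_connected_def)
    then obtain u where "(v, u) \<in> arcs_ends ?H"
      using w(2) by (cases rule: pre_digraph.converse_reachable_cases) auto
    then show ?thesis by (auto simp: arcs_ends_def arc_to_ends_def)
  qed
  then have "V \<le> card (tail (base_graph B) ` arcs (base_graph B))"
    by (intro card_mono finite_imageI finite_arcs) auto
  also have "\<dots> \<le> M" by (rule card_image_le[OF finite_arcs])
  finally show ?thesis by simp
qed simp

text \<open>
  The spatial solution contributes one input entry for each arc of the agent; this is why the number
  of arc copies is bounded by the length of the input.
\<close>
lemma input_bounds:
  assumes "well_defined B"
  defines "Q \<equiv> length (fst (tsp_input B X k)) + length (snd (tsp_input B X k)) + 2"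
  shows "M < Q" "num_layers B < Q" "V < Q" "length arc_list < Q"
    "\<And>m. m \<in> {1..M} \<Longrightarrow> length (unav B m) < Q"
proof -
  have len: "length (fst (tsp_input B X k)) = 3 + 4 * M + (2 + length arc_list)"
    unfolding tsp_input_eq using length_arc_blocks[of M] by (simp add: agent_arc_list_eq)
  have "R \<le> M" by (rule card_mono[OF finite_arcs]) (use wf in \<open>simp add: well_formed_def\<close>)
  with len verts_le_arcs[OF assms(1)] show "M < Q" "num_layers B < Q" "V < Q" "length arc_list < Q"
    by (simp_all add: Q_def num_layers_def)
  fix m assume m: "m \<in> {1..M}"
  have "2 * length (unav B m) \<le> length (real_block m)" by (simp add: real_block_def length_pairs)
  also have "\<dots> \<le> length (snd (tsp_input B X k))"
    unfolding tsp_input_eq snd_conv by (rule member_length_concat) (use m in auto)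
  finally show "length (unav B m) < Q" by (simp add: Q_def)
qed

lemma length_all_windows:
  assumes "\<And>m. m \<in> {1..M} \<Longrightarrow> length (unav B m) < Q" "length arc_list < Q"
  shows "length (all_windows arc_list) < Q * Q"
proof -
  have "length (windows a) \<le> Q" if "a \<in> set arc_list" for a
    using that assms(1) arc_list_iff in_arcs_iff by (fastforce simp: windows_def agent_arcs_def)
  then have "length (all_windows P) \<le> length P * Q" if "set P \<subseteq> set arc_list" for P
    using that by (induction P) (auto simp: all_windows_def intro: add_mono trans_le_add2)
  from this[of arc_list] have "length (all_windows arc_list) \<le> length arc_list * Q" by simp
  also have "\<dots> < Q * Q" using assms(2) by (intro mult_less_mono1) auto
  finally show ?thesis .
qed

theorem reach_solve_tsp:
  assumes wd: "well_defined B" and k: "k \<in> agents B"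
  shows "reach solve_tsp (load (tsp_input B X k))
    (5000 * (length (fst (tsp_input B X k)) + length (snd (tsp_input B X k)) + 2) ^ 4) (tsp_answer B X k)"
proof -
  define Q where "Q = length (fst (tsp_input B X k)) + length (snd (tsp_input B X k)) + 2"
  note Q = input_bounds[OF wd, folded Q_def]
  let ?As = "precs arc_list" and ?Bs = "all_windows arc_list" and ?N = "num_layers B * V"
  have Q_pos: "0 < Q" by (simp add: Q_def)
  then have pos: "1 \<le> Q * Q" "Q \<le> Q * Q" by (simp_all add: Suc_leI)
  have As: "length ?As < Q" using Q(4) by (simp add: precs_def le_less_trans[OF length_filter_le])
  have Bs: "length ?Bs < Q * Q" by (rule length_all_windows[OF Q(5) Q(4)])
  have N: "?N < Q * Q" using Q(2,3) by (intro mult_strict_mono) auto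
  obtain G f where Gf: "(sweep ?As ?Bs ^^ (?N + length ?Bs + 3)) (\<lambda>_. 0, 0) = (G, f)" by fastforce
  let ?t1 = "Q * (60 + 63) + ((60 + (60 + Q * (90 + 63))) + Q * ((80 + (Q * (layer_time Q + 63) + 80)) + 63))"
  let ?t2 = "5 * (Q * Q) * (7 + (Q * (60 + 63) + Q * Q * (60 + 63)) + 63)"
  let ?t3 = "3 * (Q * Q) * (60 + 63) + 60"
  let ?post = "\<lambda>s' :: state. nmem s' 0 0 = f \<and> (\<forall>i<?N + 2. rmem s' 0 i = G i)"
  have "reach solve_tsp (load (tsp_input B X k)) (?t1 + (?t2 + ?t3)) ?post"
    unfolding solve_tsp_def
  proof (rule reach_Seq[OF reach_collect[OF Q(1,2,5)]], assumption)
    fix s assume "\<exists>rp. collected arc_list rp s"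
    then have "sweeping ?N ?As ?Bs (\<lambda>_. 0, 0) s"
      by (auto simp: collected_def collecting_def sweeping_def)
    then have "reach sweeps s ?t2 (sweeping ?N ?As ?Bs (G, f))"
      using reach_sweeps[of ?N ?As ?Bs "(\<lambda>_. 0, 0)" s Q "Q * Q" "5 * (Q * Q)"] As Bs N pos Gf by simp
    then show "reach (Seq sweeps write_answer) s (?t2 + ?t3) ?post"
    proof (rule reach_Seq)
      fix s' assume "sweeping ?N ?As ?Bs (G, f) s'"
      then show "reach write_answer s' ?t3 ?post"
        by (rule reach_write_answer) (use N pos in linarith)
    qed
  qed
  then show ?thesis
  proof (rule reach_mono)
    have "?t1 + (?t2 + ?t3) =
        180 + 499 * Q + 931 * (Q * Q) + 798 * (Q * Q * Q) + 615 * (Q * Q * Q * Q)"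
      by (simp add: layer_time_def algebra_simps)
    moreover have "Q * Q \<le> Q * Q * Q" "Q * Q * Q \<le> Q * Q * Q * Q"
      using Q_pos by (simp_all add: Suc_leI)
    ultimately have "?t1 + (?t2 + ?t3) \<le> 5000 * (Q * Q * Q * Q)" using pos by linarith
    then show "?t1 + (?t2 + ?t3) \<le> 5000 * (length (fst (tsp_input B X k)) + length (snd (tsp_input B X k)) + 2) ^ 4"
      unfolding Q_def[symmetric] by (simp add: power4_eq_xxxx)
  next
    fix s' assume post: "?post s'"
    have inst: "sound_instance (?N + 2) ?As ?Bs" by (rule sound_instance_arc_list[OF k])
    from sweeps_solve[OF inst _ Gf] consider
        (yes) "f = 1" "schedule ?As ?Bs G" "\<forall>H. schedule ?As ?Bs H \<longrightarrow> (\<forall>i. G i \<le> H i)"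
      | (no) "f = 0" "\<nexists>H. schedule ?As ?Bs H" by auto
    then show "tsp_answer B X k s'"
    proof cases
      case yes
      then have "tsp_optimal B X k (\<lambda>v. rmem s' 0 (vertex_index B v))"
        using post by (intro optimal_of_least_schedule[OF k]) auto
      with yes post show ?thesis by (simp add: tsp_answer_def)
    next
      case no
      then have "\<not> tsp_feasible B X k \<Gamma>" for \<Gamma> using schedule_of_feasible by metis
      with no post show ?thesis by (simp add: tsp_answer_def)
    qed
  qed
qed

end

section \<open>Polynomial-time solvability\<close>

theorem mainTheorem2:
  shows "solvable_in_polynomial_time
    {(B, X :: nat \<Rightarrow> rarc \<Rightarrow> nat, n :: nat, k).
       well_formed B \<and> well_defined B \<and> (\<exists>Tp. recurrent B Tp) \<and>
       1 \<le> n \<and> k \<in> agents B \<and> X n \<in> spatial_solutions B}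
    (\<lambda>(B, X, n, k). tsp_input B (X n) k)
    (\<lambda>(B, X, n, k). tsp_answer B (X n) k)"
proof (rule solvable_by_reach[of _ solve_tsp _ 5000 4])
  fix x :: "base \<times> (nat \<Rightarrow> rarc \<Rightarrow> nat) \<times> nat \<times> nat"
  obtain B X n k where x: "x = (B, X, n, k)" by (cases x)
  assume "x \<in> {(B, X, n, k). well_formed B \<and> well_defined B \<and> (\<exists>Tp. recurrent B Tp) \<and>
       1 \<le> n \<and> k \<in> agents B \<and> X n \<in> spatial_solutions B}"
  then have "well_formed B" "well_defined B" "k \<in> agents B" by (auto simp: x)
  then have "reach solve_tsp (load (tsp_input B (X n) k))
      (5000 * (length (fst (tsp_input B (X n) k)) + length (snd (tsp_input B (X n) k)) + 2) ^ 4)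
      (tsp_answer B (X n) k)"
    by (intro tsp_instance.reach_solve_tsp tsp_instance.intro)
  then show "reach solve_tsp (load (case x of (B, X, n, k) \<Rightarrow> tsp_input B (X n) k))
      (5000 * (length (fst (case x of (B, X, n, k) \<Rightarrow> tsp_input B (X n) k)) +
         length (snd (case x of (B, X, n, k) \<Rightarrow> tsp_input B (X n) k)) + 2) ^ 4)
      (case x of (B, X, n, k) \<Rightarrow> tsp_answer B (X n) k)"
    by (simp add: x)
qed

end
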